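(* Let $G=(A\cup B,E)$ be a finite simple bipartite graph with $|A|=n_1$, $|B|=n_2$, $n_1\le n_2$, $n=n_1+n_2$ vertices and $m$ edges, and let $\Delta'=\min\{\Delta_A,\Delta_B\}$ where $\Delta_A=\max_{a\in A}d(a)$, $\Delta_B=\max_{b\in B}d(b)$. Then there is a randomized algorithm that, in $O(\Delta'(m+n)\ln n_2)$ time, generates with high probability a cube representation of $G$ in $3(\Delta'+2)\lceil\ln n_2\rceil$ dimensions.
   Context: A $k$-cube is a product $R_1\times\cdots\times R_k$ of closed real intervals of the form $[a_i,a_i+1]$; a $k$-cube representation of $G$ is an assignment of $k$-cubes to the vertices such that two vertices are adjacent iff their cubes intersect. $d(v)$ is the degree of $v$. The time bound assumes a uniformly random permutation of $r$ elements can be generated in $O(r)$ time.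
   Formalization: The formal theorem assumes n_2 ≥ 2 (for n_2 = 1 the time and dimension bounds are 0 and the claim fails), uses max{1,Δ'} for Δ' in the time bound (0 for edgeless graphs), takes vertices to be natural numbers, and reads high probability as 1 − C/n. *)

theory Defs
  imports "HOL-Probability.Probability" "HOL-Combinatorics.Multiset_Permutations"
begin

section \<open>Bipartite graphs and cube representations\<close>

definition bipartite_graph :: "'v set \<Rightarrow> 'v set \<Rightarrow> 'v set set \<Rightarrow> bool" where
  "bipartite_graph A B E \<longleftrightarrow>
     finite A \<and> finite B \<and> A \<inter> B = {} \<and> E \<subseteq> {{a, b} | a b. a \<in> A \<and> b \<in> B}"

definition degree :: "'v set set \<Rightarrow> 'v \<Rightarrow> nat" where
  "degree E v = card {e \<in> E. v \<in> e}"

text \<open>The \<open>insert 0\<close> only matters for an empty side, whose maximum degree is taken to be 0.\<close>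

definition max_degree :: "'v set set \<Rightarrow> 'v set \<Rightarrow> nat" where
  "max_degree E S = Max (insert 0 (degree E ` S))"

definition cube :: "nat \<Rightarrow> (nat \<Rightarrow> real) \<Rightarrow> (nat \<Rightarrow> real) set" where
  "cube k a = (\<Pi>\<^sub>E i\<in>{..<k}. {a i .. a i + 1})"

definition cube_representation ::
  "nat \<Rightarrow> 'v set \<Rightarrow> 'v set set \<Rightarrow> ('v \<Rightarrow> (nat \<Rightarrow> real) set) \<Rightarrow> bool" where
  "cube_representation k V E f \<longleftrightarrow>
     (\<forall>v\<in>V. \<exists>a. f v = cube k a) \<and>
     (\<forall>u\<in>V. \<forall>v\<in>V. u \<noteq> v \<longrightarrow> ({u, v} \<in> E \<longleftrightarrow> f u \<inter> f v \<noteq> {}))"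


section \<open>A randomized random-access machine\<close>

text \<open>
  Structured programs for a unit-cost RAM with addition and truncated subtraction (and no
  multiplication) on natural numbers, operating on registers and on an indirectly addressed
  memory. The only source of randomness is \<open>RandPerm r s\<close>: it writes a uniformly random
  permutation of \<open>0, \<dots>, l - 1\<close>, where \<open>l\<close> is the content of register \<open>s\<close>, to the \<open>l\<close> memory
  cells starting at the address held in register \<open>r\<close>, and is charged \<open>l + 1\<close> time units.
  This is the assumption that a random permutation of \<open>l\<close> elements takes time \<open>O(l)\<close>.
\<close>

datatype prog =
    Const nat nat
  | Add nat nat nat
  | Sub nat nat nat
  | Load nat nat
  | Store nat nat
  | RandPerm nat nat
  | Seq prog prog
  | IfNZ nat prog prog
  | WhileNZ nat prog

record state =
  reg :: "nat \<Rightarrow> nat"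
  mem :: "nat \<Rightarrow> nat"
  elapsed :: nat

definition charge :: "nat \<Rightarrow> state \<Rightarrow> state" where
  "charge t s = s\<lparr>elapsed := elapsed s + t\<rparr>"

definition set_reg :: "nat \<Rightarrow> nat \<Rightarrow> state \<Rightarrow> state" where
  "set_reg r x s = s\<lparr>reg := (reg s)(r := x)\<rparr>"

definition write_list :: "nat \<Rightarrow> nat list \<Rightarrow> state \<Rightarrow> state" where
  "write_list b xs s =
     s\<lparr>mem := (\<lambda>x. if b \<le> x \<and> x < b + length xs then xs ! (x - b) else mem s x)\<rparr>"

text \<open>
  \<open>exec f p s\<close> is the distribution of the final state; the fuel \<open>f\<close> bounds the nesting depth of
  the evaluation, and \<open>None\<close> stands for fuel exhaustion. Fuel is not the running time, which is
  accumulated in the field \<open>elapsed\<close>. If \<open>None\<close> is not in the support for some fuel, then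
  the distribution is the same for all larger amounts of fuel.
\<close>

fun exec :: "nat \<Rightarrow> prog \<Rightarrow> state \<Rightarrow> state option pmf" where
  "exec 0 p s = return_pmf None"
| "exec (Suc f) (Const r c) s = return_pmf (Some (charge 1 (set_reg r c s)))"
| "exec (Suc f) (Add r x y) s =
     return_pmf (Some (charge 1 (set_reg r (reg s x + reg s y) s)))"
| "exec (Suc f) (Sub r x y) s =
     return_pmf (Some (charge 1 (set_reg r (reg s x - reg s y) s)))"
| "exec (Suc f) (Load r x) s =
     return_pmf (Some (charge 1 (set_reg r (mem s (reg s x)) s)))"
| "exec (Suc f) (Store r x) s =
     return_pmf (Some (charge 1 (write_list (reg s r) [reg s x] s)))"
| "exec (Suc f) (RandPerm r x) s =
     map_pmf (\<lambda>xs. Some (charge (reg s x + 1) (write_list (reg s r) xs s)))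
       (pmf_of_set (permutations_of_set {0..<reg s x}))"
| "exec (Suc f) (Seq p q) s =
     bind_pmf (exec f p s)
       (\<lambda>res. case res of None \<Rightarrow> return_pmf None | Some s' \<Rightarrow> exec f q s')"
| "exec (Suc f) (IfNZ r p q) s =
     (if reg s r \<noteq> 0 then exec f p (charge 1 s) else exec f q (charge 1 s))"
| "exec (Suc f) (WhileNZ r p) s =
     (if reg s r \<noteq> 0
      then bind_pmf (exec f p (charge 1 s))
             (\<lambda>res. case res of None \<Rightarrow> return_pmf None | Some s' \<Rightarrow> exec f (WhileNZ r p) s')
      else return_pmf (Some (charge 1 s)))"

definition initial_state :: "nat list \<Rightarrow> state" where
  "initial_state xs =
     \<lparr>reg = (\<lambda>_. 0), mem = (\<lambda>x. if x < length xs then xs ! x else 0), elapsed = 0\<rparr>"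


section \<open>Input and output conventions\<close>

text \<open>
  The input is the two sides, numbered in an arbitrary order, and the list of the edges in an
  arbitrary order, each edge being a pair of an index into \<open>as\<close> and an index into \<open>bs\<close>.
\<close>

definition edge_list_of ::
  "'v list \<Rightarrow> 'v list \<Rightarrow> (nat \<times> nat) list \<Rightarrow> 'v set \<Rightarrow> 'v set \<Rightarrow> 'v set set \<Rightarrow> bool" where
  "edge_list_of as bs es A B E \<longleftrightarrow>
     distinct as \<and> set as = A \<and> distinct bs \<and> set bs = B \<and>
     distinct es \<and> set es \<subseteq> {..<length as} \<times> {..<length bs} \<and>
     E = (\<lambda>(i, j). {as ! i, bs ! j}) ` set es"

definition graph_input :: "'v list \<Rightarrow> 'v list \<Rightarrow> (nat \<times> nat) list \<Rightarrow> nat list" where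
  "graph_input as bs es =
     [length as, length bs, length es] @ concat (map (\<lambda>(i, j). [i, j]) es)"

text \<open>
  Coordinates are output as fractions with a common denominator, held in register 1. Register 0
  holds the address of the table of numerators, which is stored dimension by dimension: the lower
  end of the \<open>i\<close>-th interval of the \<open>j\<close>-th vertex in \<open>vs\<close> is at offset \<open>i * length vs + j\<close>.
\<close>

definition output_cube :: "nat \<Rightarrow> nat \<Rightarrow> state \<Rightarrow> nat \<Rightarrow> (nat \<Rightarrow> real) set" where
  "output_cube k n s j =
     cube k (\<lambda>i. real (mem s (reg s 0 + i * n + j)) / real (reg s 1))"

definition outputs_cube_representation ::
  "nat \<Rightarrow> 'v list \<Rightarrow> 'v set set \<Rightarrow> state \<Rightarrow> bool" where
  "outputs_cube_representation k vs E s \<longleftrightarrow>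
     reg s 1 > 0 \<and>
     (\<exists>f. cube_representation k (set vs) E f \<and>
          (\<forall>j<length vs. f (vs ! j) = output_cube k (length vs) s j))"

end

theory Submission
  imports Defs
begin

text \<open>
  Let \<open>Y\<close> be the side with the smaller maximum degree, \<open>X\<close> the other one, and \<open>n\<close> the unit of
  length. A random row places \<open>x \<in> X\<close> at its position \<open>\<pi> x < n\<close> in a random permutation and
  \<open>y \<in> Y\<close> at \<open>n\<close> plus the minimum of \<open>\<pi>\<close> over the neighbours of \<open>y\<close> (at \<open>2 n\<close> if there are none).
  Neighbours always meet, and a nonadjacent pair \<open>x\<close>, \<open>y\<close> is separated whenever \<open>x\<close> precedes all
  neighbours of \<open>y\<close>, which has probability at least \<open>1 / (\<Delta> + 1)\<close>. Pairs on the same side are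
  separated deterministically by the binary digits of the vertex numbers: all of the other side
  is placed at \<open>n\<close>, and a vertex of this side at \<open>0\<close> or \<open>2 n\<close> according to a digit.
  The digits take about \<open>2 log\<^sub>2 n\<close> rows, which may exceed the \<open>3 \<lceil>ln n2\<rceil>\<close> rows left by
  \<open>3 (\<Delta> + 1) \<lceil>ln n2\<rceil>\<close> random rows, but saving a constant number of groups of \<open>3 (\<Delta> + 1)\<close>
  random rows costs only a constant factor in the failure probability. This also means that
  \<open>ln n2\<close> is needed only up to an additive constant; the machine obtains it in time
  \<open>O(n2 ln n2)\<close> from the harmonic sum of the \<open>\<lceil>n2 / i\<rceil>\<close>. Rows that are never written stay zero and
  separate nothing.
\<close>

section \<open>Reasoning about programs\<close>

text \<open>The machine has neither multiplication nor a logarithm, so every quantity must be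
  reached by additions and subtractions within the time bound. Correctness splits into facts that
  hold surely, treated with \<open>wp\<close>, and one random event for each nonadjacent pair from
  opposite sides, namely that no random row separates it. That event is bounded row by row: whatever
  the earlier rows are, the next one fails with probability at most \<Delta> / (\<Delta> + 1), so a
  group of 3 (\<Delta> + 1) rows fails with probability at most exp (-3). With ln n2 groups this
  would be n2 ^ (-3), small enough for a union bound over at most n2 ^ 2 pairs; five groups are left
  out, which costs the factor exp 15. The dimensions suffice because 1 / ln 2 \<le> 3 / 2: with
  \<open>K\<close> binary digits, 2 K \<le> 3 \<lceil>ln n2\<rceil> + 4, so the digit rows overrun
  their share by at most four rows, whatever \<Delta> is.\<close>

notation Seq (infixr ";;" 60)

text \<open>"Eventually" hides the fuel, and \<open>map_pmf Some\<close> excludes its exhaustion.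
  The support is finite so that one amount of fuel serves all states in which a continuation may
  start.\<close>

definition yields :: "prog \<Rightarrow> state \<Rightarrow> state pmf \<Rightarrow> bool" where
  "yields p s D \<longleftrightarrow> finite (set_pmf D) \<and> (\<forall>\<^sub>F f in sequentially. exec f p s = map_pmf Some D)"

lemma yieldsI:
  assumes "finite (set_pmf D)" "\<forall>\<^sub>F f in sequentially. exec (Suc f) p s = map_pmf Some D"
  shows "yields p s D"
  using assms eventually_sequentially_Suc[of "\<lambda>f. exec f p s = map_pmf Some D"]
  by (simp add: yields_def)

text \<open>\<open>Seq\<close> and one more round of \<open>WhileNZ\<close> unfold to the same bind,
  so both rules rest on this step. Finitely many intermediate states admit a common threshold for
  the fuel.\<close>

lemma eventually_bind_exec:
  assumes "yields p s D" "\<And>s'. s' \<in> set_pmf D \<Longrightarrow> yields q s' (F s')"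
  shows "\<forall>\<^sub>F f in sequentially.
     bind_pmf (exec f p s) (\<lambda>res. case res of None \<Rightarrow> return_pmf None | Some s' \<Rightarrow> exec f q s')
       = map_pmf Some (bind_pmf D F)"
proof -
  have "\<forall>\<^sub>F f in sequentially. \<forall>s'\<in>set_pmf D. exec f q s' = map_pmf Some (F s')"
    using assms by (intro eventually_ball_finite) (auto simp: yields_def)
  moreover have "\<forall>\<^sub>F f in sequentially. exec f p s = map_pmf Some D"
    using assms(1) by (simp add: yields_def)
  ultimately show ?thesis
  proof eventually_elim
    case (elim f)
    have "bind_pmf D (exec f q) = bind_pmf D (\<lambda>s'. map_pmf Some (F s'))"
      using elim by (intro bind_pmf_cong) auto
    then show ?case using elim by (simp add: bind_map_pmf map_bind_pmf)
  qed
qed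

lemma yields_Seq:
  assumes "yields p s D" "\<And>s'. s' \<in> set_pmf D \<Longrightarrow> yields q s' (F s')"
  shows "yields (p ;; q) s (bind_pmf D F)"
  using assms eventually_bind_exec[OF assms]
  by (intro yieldsI) (auto simp: yields_def)

lemma yields_While_step:
  assumes "reg s r \<noteq> 0" "yields p (charge 1 s) D"
    "\<And>s'. s' \<in> set_pmf D \<Longrightarrow> yields (WhileNZ r p) s' (F s')"
  shows "yields (WhileNZ r p) s (bind_pmf D F)"
  using assms eventually_bind_exec[OF assms(2,3)]
  by (intro yieldsI) (auto simp: yields_def)

lemma yields_While_exit:
  assumes "reg s r = 0"
  shows "yields (WhileNZ r p) s (return_pmf (charge 1 s))"
  using assms by (intro yieldsI) auto

lemma yields_IfNZ:
  assumes "yields (if reg s r \<noteq> 0 then p else q) (charge 1 s) D"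
  shows "yields (IfNZ r p q) s D"
  using assms by (cases "reg s r = 0"; intro yieldsI) (auto simp: yields_def)

lemma yields_RandPerm:
  "yields (RandPerm r x) s
     (map_pmf (\<lambda>xs. charge (reg s x + 1) (write_list (reg s r) xs s))
       (pmf_of_set (permutations_of_set {0..<reg s x})))"
  by (intro yieldsI) (auto simp: pmf.map_comp o_def)

lemma state_simps [simp]:
  "reg (charge t s) = reg s" "mem (charge t s) = mem s" "elapsed (charge t s) = elapsed s + t"
  "reg (set_reg r x s) = (reg s)(r := x)" "mem (set_reg r x s) = mem s"
  "elapsed (set_reg r x s) = elapsed s"
  "reg (write_list b xs s) = reg s" "elapsed (write_list b xs s) = elapsed s"
  "mem (write_list b [y] s) = (mem s)(b := y)"
  by (auto simp: charge_def set_reg_def write_list_def fun_eq_iff)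

text \<open>Total correctness on the whole support. Probabilities are forgotten, so this serves for
  the parts of the program whose outcome is described by facts that hold surely.\<close>

definition wp :: "prog \<Rightarrow> state \<Rightarrow> (state \<Rightarrow> bool) \<Rightarrow> bool" where
  "wp p s Q \<longleftrightarrow> (\<exists>D. yields p s D \<and> (\<forall>s'\<in>set_pmf D. Q s'))"

lemma wp_return:
  assumes "\<And>f. exec (Suc f) p s = return_pmf (Some s')" "Q s'"
  shows "wp p s Q"
  using assms unfolding wp_def by (intro exI[of _ "return_pmf s'"]) (auto intro!: yieldsI)

lemma wp_basic:
  "Q (charge 1 (set_reg r c s)) \<Longrightarrow> wp (Const r c) s Q"
  "Q (charge 1 (set_reg r (reg s x + reg s y) s)) \<Longrightarrow> wp (Add r x y) s Q"
  "Q (charge 1 (set_reg r (reg s x - reg s y) s)) \<Longrightarrow> wp (Sub r x y) s Q"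
  "Q (charge 1 (set_reg r (mem s (reg s x)) s)) \<Longrightarrow> wp (Load r x) s Q"
  "Q (charge 1 (write_list (reg s r) [reg s x] s)) \<Longrightarrow> wp (Store r x) s Q"
  by (rule wp_return; simp)+

lemma wp_Seq: "wp p s (\<lambda>s'. wp q s' Q) \<Longrightarrow> wp (p ;; q) s Q"
proof -
  assume "wp p s (\<lambda>s'. wp q s' Q)"
  then obtain D F where D: "yields p s D"
    and F: "\<And>s'. s' \<in> set_pmf D \<Longrightarrow> yields q s' (F s') \<and> (\<forall>s''\<in>set_pmf (F s'). Q s'')"
    unfolding wp_def by metis
  show ?thesis unfolding wp_def
  proof (intro exI conjI ballI)
    show "yields (p ;; q) s (bind_pmf D F)" using yields_Seq[OF D] F by blast
    show "Q s'" if "s' \<in> set_pmf (bind_pmf D F)" for s' using that F by auto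
  qed
qed

lemma wp_IfNZ:
  "(reg s r \<noteq> 0 \<Longrightarrow> wp p (charge 1 s) Q) \<Longrightarrow> (reg s r = 0 \<Longrightarrow> wp q (charge 1 s) Q) \<Longrightarrow>
   wp (IfNZ r p q) s Q"
  unfolding wp_def using yields_IfNZ[of s r p q] by (cases "reg s r = 0") auto

section \<open>Probabilities of events that must persist through a loop\<close>

text \<open>Mass can reach \<open>S\<close> only through \<open>T\<close>, and from there with
  probability at most \<open>b\<close>. This takes the place of independence of successive rows: the
  bound \<open>b\<close> is uniform in the state reached.\<close>

lemma prob_bind_pmf_le:
  assumes "measure_pmf.prob D T \<le> a" "0 \<le> b"
    and "\<And>s. s \<in> set_pmf D \<Longrightarrow> s \<in> T \<Longrightarrow> measure_pmf.prob (F s) S \<le> b"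
    and "\<And>s. s \<in> set_pmf D \<Longrightarrow> s \<notin> T \<Longrightarrow> set_pmf (F s) \<inter> S = {}"
  shows "measure_pmf.prob (bind_pmf D F) S \<le> a * b"
proof -
  have *: "measure_pmf.prob (F s) S \<le> b * indicator T s" if "s \<in> set_pmf D" for s
    using assms(3,4)[OF that] measure_pmf_zero_iff[of "F s" S] by (cases "s \<in> T") auto
  have "measure_pmf.prob (bind_pmf D F) S
      = (\<integral>s. measure_pmf.prob (F s) S \<partial>measure_pmf D)"
    unfolding measure_pmf_bind
    by (subst measure_pmf.measure_bind[where N = "count_space UNIV"])
       (auto simp: measurable_def space_subprob_algebra intro!: prob_space_imp_subprob_space measure_pmf.prob_space_axioms)
  also have "\<dots> \<le> (\<integral>s. b * indicator T s \<partial>measure_pmf D)"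
    using * \<open>0 \<le> b\<close>
    by (intro integral_mono_AE measure_pmf.integrable_const_bound[where B = 1]
         measure_pmf.integrable_const_bound[where B = b])
       (auto simp: AE_measure_pmf_iff split: split_indicator)
  also have "\<dots> = b * measure_pmf.prob D T" by simp
  also have "\<dots> \<le> a * b" using assms(1,2) by (simp add: mult.commute[of a] mult_left_mono)
  finally show ?thesis .
qed

text \<open>A \<open>bad\<close> event that has been refuted stays refuted, and from every state
  satisfying the invariant an iteration keeps it alive with probability at most \<open>q\<close>;
  hence the power. The whole family of events refers to a single \<open>D\<close>, so that a union
  bound can be taken later.\<close>

lemma yields_While_prob:
  fixes bad :: "'i \<Rightarrow> state \<Rightarrow> bool" and q :: real
  assumes inv: "I j s" "j \<le> N" and "0 \<le> q"
    and step: "\<And>j s. j < N \<Longrightarrow> I j s \<Longrightarrow> reg s r \<noteq> 0 \<and> (\<exists>D. yields p (charge 1 s) D \<and>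
        (\<forall>s'\<in>set_pmf D. I (Suc j) s' \<and> (\<forall>i. bad i s' \<longrightarrow> bad i s)) \<and>
        (\<forall>i. measure_pmf.prob D {s'. bad i s'} \<le> q))"
    and exit: "\<And>s. I N s \<Longrightarrow> reg s r = 0 \<and> Q (charge 1 s) \<and> (\<forall>i. bad i (charge 1 s) \<longrightarrow> bad i s)"
  shows "\<exists>D. yields (WhileNZ r p) s D \<and>
      (\<forall>s'\<in>set_pmf D. Q s' \<and> (\<forall>i. bad i s' \<longrightarrow> bad i s)) \<and>
      (\<forall>i. measure_pmf.prob D {s'. bad i s'} \<le> q ^ (N - j))"
  using inv
proof (induction "N - j" arbitrary: j s)
  case 0
  then have "I N s" by simp
  then show ?case using exit[of s] 0 yields_While_exit[of s r p]
    by (intro exI[of _ "return_pmf (charge 1 s)"]) auto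
next
  case (Suc k)
  then have j: "j < N" by simp
  obtain D where r: "reg s r \<noteq> 0" and D: "yields p (charge 1 s) D"
    "\<And>s'. s' \<in> set_pmf D \<Longrightarrow> I (Suc j) s'" "\<And>s' i. s' \<in> set_pmf D \<Longrightarrow> bad i s' \<Longrightarrow> bad i s"
    "\<And>i. measure_pmf.prob D {s'. bad i s'} \<le> q"
    using step[OF j Suc.prems(1)] by blast
  have "\<forall>s'\<in>set_pmf D. \<exists>D'. yields (WhileNZ r p) s' D' \<and>
      (\<forall>s''\<in>set_pmf D'. Q s'' \<and> (\<forall>i. bad i s'' \<longrightarrow> bad i s')) \<and>
      (\<forall>i. measure_pmf.prob D' {s''. bad i s''} \<le> q ^ (N - Suc j))"
    using Suc.hyps(2) j D(2) by (intro ballI Suc.hyps(1)) auto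
  from bchoice[OF this] obtain F where F': "\<forall>s'\<in>set_pmf D. yields (WhileNZ r p) s' (F s') \<and>
      (\<forall>s''\<in>set_pmf (F s'). Q s'' \<and> (\<forall>i. bad i s'' \<longrightarrow> bad i s')) \<and>
      (\<forall>i. measure_pmf.prob (F s') {s''. bad i s''} \<le> q ^ (N - Suc j))" ..
  then have F: "\<And>s'. s' \<in> set_pmf D \<Longrightarrow> yields (WhileNZ r p) s' (F s')"
    "\<And>s' s''. s' \<in> set_pmf D \<Longrightarrow> s'' \<in> set_pmf (F s') \<Longrightarrow> Q s''"
    "\<And>s' s'' i. s' \<in> set_pmf D \<Longrightarrow> s'' \<in> set_pmf (F s') \<Longrightarrow> bad i s'' \<Longrightarrow> bad i s'"
    "\<And>s' i. s' \<in> set_pmf D \<Longrightarrow> measure_pmf.prob (F s') {s''. bad i s''} \<le> q ^ (N - Suc j)"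
    by blast+
  have "measure_pmf.prob (bind_pmf D F) {s''. bad i s''} \<le> q ^ (N - j)" for i
  proof -
    have "measure_pmf.prob (bind_pmf D F) {s''. bad i s''} \<le> q * q ^ (N - Suc j)"
      using F(3,4) D(4) \<open>0 \<le> q\<close> by (intro prob_bind_pmf_le[where T = "{s'. bad i s'}"]) auto
    also have "\<dots> = q ^ (N - j)" using j by (metis Suc_diff_Suc power_Suc)
    finally show ?thesis .
  qed
  moreover have "Q s'' \<and> (\<forall>i. bad i s'' \<longrightarrow> bad i s)" if "s'' \<in> set_pmf (bind_pmf D F)" for s''
    using that F(2,3) D(3) by (simp add: set_bind_pmf) blast
  ultimately show ?case
    using yields_While_step[OF r D(1) F(1)] by blast
qed

lemma wp_While:
  assumes "I 0 s"
    and "\<And>j s. j < N \<Longrightarrow> I j s \<Longrightarrow> reg s r \<noteq> 0 \<and> wp p (charge 1 s) (I (Suc j))"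
    and "\<And>s. I N s \<Longrightarrow> reg s r = 0 \<and> Q (charge 1 s)"
  shows "wp (WhileNZ r p) s Q"
proof -
  \<comment> \<open>The rule for sure postconditions is the instance in which the events never
    hold.\<close>
  have "\<exists>D. yields (WhileNZ r p) s D \<and>
      (\<forall>s'\<in>set_pmf D. Q s' \<and> (\<forall>i::unit. False \<longrightarrow> False)) \<and>
      (\<forall>i::unit. measure_pmf.prob D {s'. False} \<le> 0 ^ (N - 0))"
    using assms unfolding wp_def
    by (intro yields_While_prob[where I = I and j = 0 and N = N and q = 0]) auto
  then show ?thesis unfolding wp_def by blast
qed

section \<open>The building blocks of the algorithm\<close>

definition ceil_div :: "nat \<Rightarrow> nat \<Rightarrow> nat" where
  "ceil_div a b = (a + b - 1) div b"

lemma ceil_div_mult_less: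
  assumes "b > 0" "j < ceil_div a b"
  shows "j * b < a"
proof -
  have "Suc j * b \<le> a + b - 1"
    using assms by (simp add: ceil_div_def Suc_le_eq[symmetric] less_eq_div_iff_mult_less_eq)
  then show ?thesis using assms(1) by simp
qed

lemma le_ceil_div_mult:
  assumes "b > 0"
  shows "a \<le> ceil_div a b * b"
  using dividend_less_div_times[OF assms, of "a + b - 1"] assms
  by (simp add: ceil_div_def)

text \<open>Truncated subtraction of \<open>b\<close> reaches zero after ceil (a / b) rounds, and
  each round adds register \<open>i\<close> to \<open>c\<close>. With 1 in \<open>i\<close> this is
  a division; with another factor it is a division followed by a multiplication.\<close>

definition ceil_div_prog :: "nat \<Rightarrow> nat \<Rightarrow> nat \<Rightarrow> nat \<Rightarrow> prog" where
  "ceil_div_prog a b c i = WhileNZ a (Sub a a b ;; Add c c i)"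

text \<open>Specifications are in continuation form: \<open>Q\<close> is arbitrary, and the premise
  on it lists all that is guaranteed about the final state. Used as rules they thread the known
  facts through a sequence of programs. A round costs 3, the loop test and two instructions, and the
  failing test costs 1.\<close>

lemma wp_ceil_div_prog:
  assumes regs: "a \<noteq> c" "b \<notin> {a, c}" "i \<notin> {a, c}" and b: "reg s b > 0"
    and Q: "\<And>s'. reg s' = (reg s)(a := 0, c := reg s c + ceil_div (reg s a) (reg s b) * reg s i) \<Longrightarrow>
      mem s' = mem s \<Longrightarrow> elapsed s' = elapsed s + 3 * ceil_div (reg s a) (reg s b) + 1 \<Longrightarrow> Q s'"
  shows "wp (ceil_div_prog a b c i) s Q"
proof -
  define I where "I j s' \<longleftrightarrow>
    reg s' = (reg s)(a := reg s a - j * reg s b, c := reg s c + j * reg s i) \<and>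
    mem s' = mem s \<and> elapsed s' = elapsed s + 3 * j" for j and s' :: state
  show ?thesis unfolding ceil_div_prog_def
  proof (rule wp_While[where I = I and N = "ceil_div (reg s a) (reg s b)"], goal_cases)
    case 1
    show ?case by (simp add: I_def)
  next
    case (2 j s')
    then show ?case using regs ceil_div_mult_less[OF b 2(1)]
      by (auto simp: I_def fun_eq_iff intro!: wp_Seq wp_basic)
  next
    case (3 s')
    then show ?case using regs le_ceil_div_mult[OF b, of "reg s a"]
      by (auto simp: I_def fun_eq_iff intro!: Q)
  qed
qed

text \<open>
  Register allocation: 0: table of numerators; 1: \<open>n\<close>; 2: \<open>n1\<close>; 3: \<open>n2\<close>; 4: \<open>m\<close>; 5: the
  constant 1; 6, 7: maximum degrees of the two sides; 8, 9 and 10, 11: offset and size of the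
  sides \<open>X\<close> and \<open>Y\<close> (before these are known, 8 and 10 hold the addresses of the degrees); 12, 13: address of the \<open>X\<close>-end and of the \<open>Y\<close>-end of the first edge;
  14: \<open>2 n\<close>; 15: current row of the table; 16: the harmonic sum, later the current power of two; 17: number of random rows
  still to be generated; 18: \<open>3 (\<Delta> + 1)\<close>; 19: the constant 0. The others are scratch registers.
\<close>

definition fill_prog :: "nat \<Rightarrow> nat \<Rightarrow> nat \<Rightarrow> prog" where
  "fill_prog lo len v = Add 22 15 lo ;; Add 23 len 19 ;;
     WhileNZ 23 (Store 22 v ;; Add 22 22 5 ;; Sub 23 23 5)"

lemma wp_fill_prog:
  assumes regs: "lo < 20" "len < 20" "v < 20" and const: "reg s 5 = 1" "reg s 19 = 0"
    and Q: "\<And>s'. (\<And>r. r < 20 \<Longrightarrow> reg s' r = reg s r) \<Longrightarrow>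
      mem s' = (\<lambda>x. if reg s 15 + reg s lo \<le> x \<and> x < reg s 15 + reg s lo + reg s len
                    then reg s v else mem s x) \<Longrightarrow>
      elapsed s' = elapsed s + 4 * reg s len + 3 \<Longrightarrow> Q s'"
  shows "wp (fill_prog lo len v) s Q"
proof -
  define I where "I j s' \<longleftrightarrow>
    reg s' = (reg s)(22 := reg s 15 + reg s lo + j, 23 := reg s len - j) \<and>
    mem s' = (\<lambda>x. if reg s 15 + reg s lo \<le> x \<and> x < reg s 15 + reg s lo + j
                    then reg s v else mem s x) \<and>
    elapsed s' = elapsed s + 2 + 4 * j" for j and s' :: state
  show ?thesis unfolding fill_prog_def
    apply (intro wp_Seq wp_basic)
    apply (rule wp_While[where I = I and N = "reg s len"])
    subgoal using regs const by (auto simp: I_def fun_eq_iff)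
    subgoal for j s' using regs const by (auto simp: I_def fun_eq_iff intro!: wp_Seq wp_basic)
    subgoal using regs const by (auto simp: I_def fun_eq_iff intro!: Q)
    done
qed

text \<open>The digit of the vertex number is not computed by division: register 24 counts down to
  the next multiple of the power of two, where register 25 flips between 0 and 2 n by subtraction
  from 2 n.\<close>

definition bits_prog :: prog where
  "bits_prog = Add 22 15 19 ;; Add 23 1 19 ;; Add 24 16 19 ;; Const 25 0 ;;
     WhileNZ 23 (Store 22 25 ;; Add 22 22 5 ;; Sub 23 23 5 ;; Sub 24 24 5 ;;
       IfNZ 24 (Const 26 0) (Add 24 16 19 ;; Sub 25 14 25))"

lemma wp_bits_prog:
  assumes const: "reg s 5 = 1" "reg s 19 = 0" "reg s 14 = 2 * reg s 1" and w: "reg s 16 > 0"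
    and Q: "\<And>s'. (\<And>r. r < 20 \<Longrightarrow> reg s' r = reg s r) \<Longrightarrow>
      mem s' = (\<lambda>x. if reg s 15 \<le> x \<and> x < reg s 15 + reg s 1
                    then if odd ((x - reg s 15) div reg s 16) then 2 * reg s 1 else 0
                    else mem s x) \<Longrightarrow>
      elapsed s' \<le> elapsed s + 8 * reg s 1 + 5 \<Longrightarrow> Q s'"
  shows "wp bits_prog s Q"
proof -
  define w where "w = reg s 16"
  define val where "val j = (if odd (j div w) then 2 * reg s 1 else 0)" for j
  have "w > 0" using assms by (simp add: w_def)
  define I where "I j s' \<longleftrightarrow> (\<forall>r<20. reg s' r = reg s r) \<and>
    reg s' 22 = reg s 15 + j \<and> reg s' 23 = reg s 1 - j \<and> reg s' 24 = w - j mod w \<and>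
    reg s' 25 = val j \<and>
    mem s' = (\<lambda>x. if reg s 15 \<le> x \<and> x < reg s 15 + j then val (x - reg s 15) else mem s x) \<and>
    elapsed s' \<le> elapsed s + 4 + 8 * j" for j and s' :: state
  have mem: "(\<lambda>x. if reg s 15 \<le> x \<and> x < reg s 15 + Suc j then val (x - reg s 15) else mem s x)
    = (\<lambda>x. if reg s 15 \<le> x \<and> x < reg s 15 + j then val (x - reg s 15) else mem s x)
        (reg s 15 + j := val j)" for j
    by (auto simp: fun_eq_iff)
  have r: "w - Suc j mod w = (if w - j mod w - 1 = 0 then w else w - j mod w - 1)"
    "val (Suc j) = (if w - j mod w - 1 = 0 then 2 * reg s 1 - val j else val j)" for j
    using mod_less_divisor[OF \<open>w > 0\<close>, of j] by (auto simp: mod_Suc div_Suc val_def)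
  show ?thesis unfolding bits_prog_def
    apply (intro wp_Seq wp_basic)
    apply (rule wp_While[where I = I and N = "reg s 1"])
    subgoal using const by (auto simp: I_def val_def w_def)
    subgoal for j s'
    proof (rule conjI, goal_cases)
      case 1
      then show ?case by (simp add: I_def)
    next
      case 2
      have r': "\<And>r. r < 20 \<Longrightarrow> reg s' r = reg s r" "reg s' 22 = reg s 15 + j"
        "reg s' 23 = reg s 1 - j" "reg s' 24 = w - j mod w" "reg s' 25 = val j" "reg s 16 = w"
        "mem s' = (\<lambda>x. if reg s 15 \<le> x \<and> x < reg s 15 + j then val (x - reg s 15) else mem s x)"
        and t: "elapsed s' \<le> elapsed s + 4 + 8 * j"
        using 2(2) by (simp_all add: I_def w_def)
      show ?case
        apply (intro wp_Seq wp_basic wp_IfNZ)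
        unfolding I_def mem r using const t by (simp_all add: r')
    qed
    subgoal using const by (auto simp: I_def val_def w_def intro!: Q)
    done
qed

text \<open>One pass over the edges maintains running minima, as a - (a - b) is the minimum of a and
  b under truncated subtraction.\<close>

definition relax_prog :: prog where
  "relax_prog = Add 20 4 19 ;; Add 21 12 19 ;; Add 22 13 19 ;; Add 23 15 8 ;; Add 24 15 10 ;;
     WhileNZ 20 (
       Load 25 21 ;; Add 25 25 23 ;; Load 25 25 ;; Add 25 25 1 ;;
       Load 26 22 ;; Add 26 26 24 ;; Load 27 26 ;; Sub 28 27 25 ;; Sub 27 27 28 ;; Store 26 27 ;;
       Add 21 21 5 ;; Add 21 21 5 ;; Add 22 22 5 ;; Add 22 22 5 ;; Sub 20 20 5)"

text \<open>The edge list lies below the current row, and the cells of the two ends are disjoint, so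
  everything read except the running minimum still has its original value. The guarantees say that
  each cell keeps its value or takes a candidate value of one of its edges, and that it is below all
  its candidates; this is what a minimum is used for.\<close>

lemma wp_relax_prog:
  fixes s :: state
  defines "x \<equiv> \<lambda>j. reg s 15 + reg s 8 + mem s (reg s 12 + 2 * j)"
    and "y \<equiv> \<lambda>j. reg s 15 + reg s 10 + mem s (reg s 13 + 2 * j)"
  assumes const: "reg s 5 = 1" "reg s 19 = 0"
    and below: "\<And>j. j < reg s 4 \<Longrightarrow> reg s 12 + 2 * j < reg s 15"
      "\<And>j. j < reg s 4 \<Longrightarrow> reg s 13 + 2 * j < reg s 15"
    and disj: "x ` {..<reg s 4} \<inter> y ` {..<reg s 4} = {}"
    and Q: "\<And>s'. (\<And>r. r < 20 \<Longrightarrow> reg s' r = reg s r) \<Longrightarrow>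
      (\<And>a. mem s' a = mem s a \<or> (\<exists>j<reg s 4. a = y j \<and> mem s' a = reg s 1 + mem s (x j))) \<Longrightarrow>
      (\<And>j. j < reg s 4 \<Longrightarrow> mem s' (y j) \<le> reg s 1 + mem s (x j)) \<Longrightarrow>
      elapsed s' = elapsed s + 16 * reg s 4 + 6 \<Longrightarrow> Q s'"
  shows "wp relax_prog s Q"
proof -
  define m where "m = reg s 4"
  define I where "I e s' \<longleftrightarrow> (\<forall>r<20. reg s' r = reg s r) \<and>
    reg s' 20 = m - e \<and> reg s' 21 = reg s 12 + 2 * e \<and> reg s' 22 = reg s 13 + 2 * e \<and>
    reg s' 23 = reg s 15 + reg s 8 \<and> reg s' 24 = reg s 15 + reg s 10 \<and>
    (\<forall>a. mem s' a = mem s a \<or> (\<exists>j<e. a = y j \<and> mem s' a = reg s 1 + mem s (x j))) \<and>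
    (\<forall>j<e. mem s' (y j) \<le> reg s 1 + mem s (x j)) \<and>
    elapsed s' = elapsed s + 5 + 16 * e" for e and s' :: state
  have step: "I (Suc e) s''"
    if e: "e < m" and I: "I e s'"
      and m: "mem s'' = (mem s')(y e := min (mem s' (y e)) (mem s (x e) + reg s 1))"
      and "\<forall>r<20. reg s'' r = reg s' r" "reg s'' 20 = m - Suc e" "reg s'' 21 = reg s 12 + 2 * Suc e"
      "reg s'' 22 = reg s 13 + 2 * Suc e" "reg s'' 23 = reg s' 23" "reg s'' 24 = reg s' 24"
      "elapsed s'' = elapsed s' + 16" for e s' s''
  proof -
    have "mem s'' a = mem s a \<or> (\<exists>j<Suc e. a = y j \<and> mem s'' a = reg s 1 + mem s (x j))" for a
    proof (cases "a = y e \<and> reg s 1 + mem s (x e) \<le> mem s' (y e)")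
      case True
      then show ?thesis by (auto simp: m min_def)
    next
      case False
      then have "mem s'' a = mem s' a" by (auto simp: m)
      then show ?thesis using I by (auto simp: I_def less_Suc_eq)
    qed
    moreover have "mem s'' (y j) \<le> reg s 1 + mem s (x j)" if "j < Suc e" for j
      using that I by (auto simp: I_def m less_Suc_eq min.coboundedI1)
    ultimately show ?thesis using I that by (auto simp: I_def)
  qed
  have unchanged: "mem s' a = mem s a" if "e < m" "I e s'" "a \<notin> y ` {..<m}" for e s' a
    using that unfolding I_def by (metis image_eqI lessThan_iff less_trans)
  have ybound: "reg s 15 \<le> y j" for j by (simp add: y_def)
  have min: "a - (a - b) = min a b" for a b :: nat by simp
  show ?thesis unfolding relax_prog_def
    apply (intro wp_Seq wp_basic)
    apply (rule wp_While[where I = I and N = m])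
    subgoal using const by (auto simp: I_def m_def)
    subgoal for e s'
    proof (rule conjI, goal_cases)
      case 1
      then show ?case by (simp add: I_def)
    next
      case 2
      have "reg s 12 + 2 * e \<notin> y ` {..<m}" "reg s 13 + 2 * e \<notin> y ` {..<m}" "x e \<notin> y ` {..<m}"
        using below[of e] ybound 2(1) disj by (force simp: m_def not_le[symmetric])+
      note u = this[THEN unchanged[OF 2]]
      have r: "\<And>r. r < 20 \<Longrightarrow> reg s' r = reg s r" "reg s' 20 = m - e"
        "reg s' 21 = reg s 12 + 2 * e" "reg s' 22 = reg s 13 + 2 * e"
        "reg s' 23 = reg s 15 + reg s 8" "reg s' 24 = reg s 15 + reg s 10"
        using 2(2) by (simp_all add: I_def)
      have xy: "mem s (reg s 12 + 2 * e) + (reg s 15 + reg s 8) = x e"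
        "mem s (reg s 13 + 2 * e) + (reg s 15 + reg s 10) = y e"
        by (simp_all add: x_def y_def)
      show ?case
        apply (rule wp_Seq, rule wp_basic, simp add: r u xy min const)+
        apply (rule wp_basic, rule step[OF 2])
        by (simp_all add: r u xy min const)
    qed
    subgoal unfolding I_def m_def by (rule conjI, simp, rule Q) (blast | simp)+
    done
qed

section \<open>Counting degrees along the edge list\<close>

text \<open>The recursion is on the number of edges already read, so one unfolding corresponds to
  one iteration of \<open>degree_prog\<close>.\<close>

primrec occurrences :: "(nat \<Rightarrow> nat) \<Rightarrow> nat \<Rightarrow> nat \<Rightarrow> nat" where
  "occurrences f 0 v = 0"
| "occurrences f (Suc e) v = (if f e = v then Suc (occurrences f e v) else occurrences f e v)"

primrec max_occurrences :: "(nat \<Rightarrow> nat) \<Rightarrow> nat \<Rightarrow> nat" where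
  "max_occurrences f 0 = 0"
| "max_occurrences f (Suc e) = max (max_occurrences f e) (Suc (occurrences f e (f e)))"

lemma occurrences_eq_card: "occurrences f e v = card {j. j < e \<and> f j = v}"
proof (induction e)
  case (Suc e)
  have "{j. j < Suc e \<and> f j = v} = (if f e = v then insert e else id) {j. j < e \<and> f j = v}"
    by (auto simp: less_Suc_eq)
  then show ?case using Suc by simp
qed simp

lemma occurrences_le_max: "occurrences f e v \<le> max_occurrences f e"
  by (induction e) (auto simp: le_max_iff_disj)

lemma max_occurrences_eq: "max_occurrences f e = Max (insert 0 (range (occurrences f e)))"
proof -
  note bound = occurrences_le_max[of f e]
  have attained: "max_occurrences f e = 0 \<or> (\<exists>v. max_occurrences f e = occurrences f e v)" for e
  proof (induction e)
    case (Suc e)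
    show ?case
    proof (cases "max_occurrences f e \<le> Suc (occurrences f e (f e))")
      case True
      then show ?thesis by (intro disjI2 exI[of _ "f e"]) auto
    next
      case False
      then obtain v where v: "max_occurrences f e = occurrences f e v" using Suc by auto
      \<comment> \<open>Were the old maximum attained at \<open>f e\<close>, the incremented count
        would exceed it. So the count at \<open>v\<close> is untouched by this step.\<close>
      then have "f e \<noteq> v" using False by auto
      then show ?thesis using False v by (intro disjI2 exI[of _ v]) auto
    qed
  qed simp
  have "finite (range (occurrences f e))"
  proof (rule finite_subset)
    show "range (occurrences f e) \<subseteq> {..max_occurrences f e}"
      unfolding image_subset_iff atMost_iff using bound by simp
  qed simp
  then show ?thesis
  proof (intro Max_eqI[symmetric])
    show "v \<le> max_occurrences f e" if "v \<in> insert 0 (range (occurrences f e))" for v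
      using that bound by blast
    show "max_occurrences f e \<in> insert 0 (range (occurrences f e))"
      using attained[of e] by blast
  qed simp
qed

text \<open>Memory is divided as follows: three size fields, the edges from address 3, one degree
  counter per vertex from 3 + 2 m, and the table behind the counters. Register 5 is both the
  constant 1 and the address of n2.\<close>

definition init_prog :: prog where
  "init_prog = Const 5 1 ;; Const 20 0 ;; Load 2 20 ;; Load 3 5 ;; Add 20 5 5 ;; Load 4 20 ;;
     Add 1 2 3 ;; Add 14 1 1 ;; Const 21 3 ;; Add 8 4 4 ;; Add 8 8 21 ;; Add 10 8 2 ;;
     Add 0 8 1 ;; Add 15 0 19"

text \<open>The maximum is updated without a branch, as mx + (count - mx) is the larger of the two.
  Two consecutive calls consume the two ends of an edge.\<close>

definition count_prog :: "nat \<Rightarrow> nat \<Rightarrow> prog" where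
  "count_prog base mx = Load 22 21 ;; Add 22 base 22 ;; Load 23 22 ;; Add 23 23 5 ;;
     Store 22 23 ;; Sub 23 23 mx ;; Add mx mx 23 ;; Add 21 21 5"

definition degree_prog :: prog where
  "degree_prog = Add 20 4 19 ;; Const 21 3 ;;
     WhileNZ 20 (count_prog 8 6 ;; count_prog 10 7 ;; Sub 20 20 5)"

lemma wp_degree_prog:
  fixes s :: state
  defines "f \<equiv> \<lambda>j. mem s (3 + 2 * j)" and "g \<equiv> \<lambda>j. mem s (4 + 2 * j)" and "D \<equiv> reg s 8"
  assumes const: "reg s 5 = 1" "reg s 19 = 0" "reg s 6 = 0" "reg s 7 = 0"
    and D: "D = 3 + 2 * reg s 4" "reg s 10 = D + reg s 2"
    and range: "\<And>j. j < reg s 4 \<Longrightarrow> f j < reg s 2" "\<And>j. j < reg s 4 \<Longrightarrow> g j < reg s 3"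
    and zero: "\<And>a. a \<ge> D \<Longrightarrow> mem s a = 0"
    and Q: "\<And>s'. (\<And>r. r < 20 \<Longrightarrow> r \<noteq> 6 \<Longrightarrow> r \<noteq> 7 \<Longrightarrow> reg s' r = reg s r) \<Longrightarrow>
      reg s' 6 = max_occurrences f (reg s 4) \<Longrightarrow> reg s' 7 = max_occurrences g (reg s 4) \<Longrightarrow>
      (\<And>a. a < D \<or> D + reg s 2 + reg s 3 \<le> a \<Longrightarrow> mem s' a = mem s a) \<Longrightarrow>
      elapsed s' = elapsed s + 18 * reg s 4 + 3 \<Longrightarrow> Q s'"
  shows "wp degree_prog s Q"
proof -
  define I where "I e s' \<longleftrightarrow> (\<forall>r<20. r \<noteq> 6 \<longrightarrow> r \<noteq> 7 \<longrightarrow> reg s' r = reg s r) \<and>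
    reg s' 20 = reg s 4 - e \<and> reg s' 21 = 3 + 2 * e \<and>
    reg s' 6 = max_occurrences f e \<and> reg s' 7 = max_occurrences g e \<and>
    (\<forall>a. a < D \<or> D + reg s 2 + reg s 3 \<le> a \<longrightarrow> mem s' a = mem s a) \<and>
    (\<forall>v<reg s 2. mem s' (D + v) = occurrences f e v) \<and>
    (\<forall>v<reg s 3. mem s' (D + reg s 2 + v) = occurrences g e v) \<and>
    elapsed s' = elapsed s + 2 + 18 * e" for e and s' :: state
  have max: "a + (b - a) = max a b" for a b :: nat by simp
  show ?thesis unfolding degree_prog_def
    apply (intro wp_Seq wp_basic)
    apply (rule wp_While[where I = I and N = "reg s 4"])
    subgoal using const zero by (auto simp: I_def)
    subgoal for e s'
    proof (rule conjI, goal_cases)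
      case 1
      then show ?case by (simp add: I_def)
    next
      case 2
      have e: "e < reg s 4" by fact
      have I: "\<And>r. r < 20 \<Longrightarrow> r \<noteq> 6 \<Longrightarrow> r \<noteq> 7 \<Longrightarrow> reg s' r = reg s r"
        "reg s' 20 = reg s 4 - e" "reg s' 21 = 3 + 2 * e"
        "reg s' 6 = max_occurrences f e" "reg s' 7 = max_occurrences g e"
        "elapsed s' = elapsed s + 2 + 18 * e"
        "\<And>v. v < reg s 2 \<Longrightarrow> mem s' (D + v) = occurrences f e v"
        "\<And>v. v < reg s 3 \<Longrightarrow> mem s' (D + reg s 2 + v) = occurrences g e v"
        "\<And>a. a < D \<Longrightarrow> mem s' a = mem s a"
        "\<And>a. D + reg s 2 + reg s 3 \<le> a \<Longrightarrow> mem s' a = mem s a"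
        using 2(2) by (simp_all add: I_def)
      have fe: "f e < reg s 2" and ge: "g e < reg s 3" using range e by simp_all
      \<comment> \<open>Incrementing the first counter changes neither the other end of the edge,
        which lies below the counters, nor the second counter, since \<open>f e\<close> is below the
        number of counters of the first side.\<close>
      have u: "mem s' (3 + 2 * e) = f e" "mem s' (4 + 2 * e) = g e" "reg s 8 = D"
        "4 + 2 * e \<noteq> D + f e"
        "reg s 2 + g e \<noteq> f e" "reg s 10 = D + reg s 2"
        using e fe D I(9) by (auto simp: f_def g_def D_def numeral_eq_Suc)
      show ?case
        unfolding count_prog_def
        apply (((rule wp_Seq)+)?, rule wp_basic, simp add: I u const max fe ge)+
        using I fe ge const by (auto simp: I_def u)
    qed
    subgoal unfolding I_def by (rule conjI, simp, rule Q, simp_all) (erule disjE; simp)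
    done
qed

section \<open>An integer substitute for the logarithm\<close>

text \<open>Each quotient is obtained in time proportional to its value, so the sum computed also
  bounds the time spent on it, up to a constant factor and a linear term.\<close>

definition harmonic_prog :: prog where
  "harmonic_prog = Add 20 3 19 ;; Const 16 0 ;;
     WhileNZ 20 (Add 21 3 19 ;; ceil_div_prog 21 20 16 5 ;; Sub 20 20 5)"

lemma wp_harmonic_prog:
  fixes s :: state
  defines "h \<equiv> \<Sum>i=1..reg s 3. ceil_div (reg s 3) i"
  assumes const: "reg s 5 = 1" "reg s 19 = 0"
    and Q: "\<And>s'. (\<And>r. r < 20 \<Longrightarrow> r \<noteq> 16 \<Longrightarrow> reg s' r = reg s r) \<Longrightarrow> reg s' 16 = h \<Longrightarrow>
      mem s' = mem s \<Longrightarrow> elapsed s' = elapsed s + 4 * reg s 3 + 3 * h + 3 \<Longrightarrow> Q s'"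
  shows "wp harmonic_prog s Q"
proof -
  define H where "H j = (\<Sum>i<j. ceil_div (reg s 3) (reg s 3 - i))" for j
  have [simp]: "H (Suc j) = H j + ceil_div (reg s 3) (reg s 3 - j)" "H 0 = 0" for j
    by (simp_all add: H_def)
  define I where "I j s' \<longleftrightarrow> (\<forall>r<20. r \<noteq> 16 \<longrightarrow> reg s' r = reg s r) \<and>
    reg s' 20 = reg s 3 - j \<and> reg s' 16 = H j \<and> mem s' = mem s \<and>
    elapsed s' = elapsed s + 2 + 4 * j + 3 * H j" for j and s' :: state
  \<comment> \<open>The loop counter serves as the divisor and runs downwards, so the sum is
    accumulated in reverse order.\<close>
  have h: "H (reg s 3) = h"
    unfolding H_def h_def
    by (rule sum.reindex_bij_witness[of _ "\<lambda>i. reg s 3 - i" "\<lambda>i. reg s 3 - i"]) auto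
  show ?thesis unfolding harmonic_prog_def
    apply (intro wp_Seq wp_basic)
    apply (rule wp_While[where I = I and N = "reg s 3"])
    subgoal using const by (auto simp: I_def)
    subgoal for e s'
      using const apply (intro conjI)
       apply (simp add: I_def)
      apply (intro wp_Seq wp_basic)
      apply (rule wp_ceil_div_prog)
      apply (simp_all add: I_def)
      apply (intro wp_basic)
      apply (simp add: I_def)
      done
    subgoal unfolding I_def h by (rule conjI, simp, rule Q) simp_all
    done
qed

text \<open>A nonzero truncated difference means that the second side has the smaller maximum degree
  and becomes \<open>Y\<close>; ties make the first side \<open>Y\<close>. Vertices of the second
  side are numbered after those of the first, and 3 and 4 are the addresses of the two ends of the
  first edge.\<close>

definition choose_prog :: prog where
  "choose_prog = Sub 20 6 7 ;; IfNZ 20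
     (Const 8 0 ;; Add 9 2 19 ;; Add 10 2 19 ;; Add 11 3 19 ;; Const 12 3 ;; Const 13 4 ;;
       Add 18 7 5)
     (Add 8 2 19 ;; Add 9 3 19 ;; Const 10 0 ;; Add 11 2 19 ;; Const 12 4 ;; Const 13 3 ;;
       Add 18 6 5)"

text \<open>Register 18 becomes the size of a group, 3 (\<Delta> + 1). Dividing the harmonic sum by
  n2 while adding groups yields the number of random rows directly, and the five subtractions take
  out the omitted groups.\<close>

definition rounds_prog :: prog where
  "rounds_prog = Add 20 18 18 ;; Add 18 18 20 ;; Const 17 0 ;; ceil_div_prog 16 3 17 18 ;;
     Sub 17 17 18 ;; Sub 17 17 18 ;; Sub 17 17 18 ;; Sub 17 17 18 ;; Sub 17 17 18"

text \<open>An integer that is at least ln N and less than ln N + 3, for positive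
  \<open>N\<close>.\<close>

definition rounds :: "nat \<Rightarrow> nat" where
  "rounds N = ceil_div (\<Sum>i=1..N. ceil_div N i) N"

definition setup_prog :: prog where
  "setup_prog = init_prog ;; degree_prog ;; harmonic_prog ;; choose_prog ;; rounds_prog"

lemma nth_concat_map_pairs:
  assumes "j < length xs"
  shows "concat (map (\<lambda>(i, j). [i, j]) xs) ! (2 * j) = fst (xs ! j)"
    "concat (map (\<lambda>(i, j). [i, j]) xs) ! Suc (2 * j) = snd (xs ! j)"
  using assms by (induction xs arbitrary: j) (auto simp: nth_Cons split: nat.split)

lemma length_concat_map_pairs: "length (concat (map (\<lambda>(i, j). [i, j]) xs)) = 2 * length xs"
  by (induction xs) auto

lemma wp_init_prog:
  assumes zero: "\<And>r. reg s r = 0"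
    and Q: "\<And>s'. (\<And>r. r < 20 \<Longrightarrow> reg s' r =
        (if r = 0 \<or> r = 15 then 3 + 2 * mem s 2 + mem s 0 + mem s 1 else
         if r = 1 then mem s 0 + mem s 1 else if r = 2 then mem s 0 else if r = 3 then mem s 1 else
         if r = 4 then mem s 2 else if r = 5 then 1 else if r = 8 then 3 + 2 * mem s 2 else
         if r = 10 then 3 + 2 * mem s 2 + mem s 0 else if r = 14 then 2 * (mem s 0 + mem s 1)
         else 0)) \<Longrightarrow>
      mem s' = mem s \<Longrightarrow> elapsed s' = elapsed s + 14 \<Longrightarrow> Q s'"
  shows "wp init_prog s Q"
proof -
  have [simp]: "Suc (Suc 0) = 2" by simp
  show ?thesis unfolding init_prog_def
    apply (rule wp_Seq, rule wp_basic, simp add: zero)+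
    apply (rule wp_basic, rule Q)
    by (simp_all add: zero)
qed

lemma wp_choose_prog:
  assumes const: "reg s 5 = 1" "reg s 19 = 0"
    and Q: "\<And>s'. (\<And>r. r < 20 \<Longrightarrow> r \<notin> {8, 9, 10, 11, 12, 13, 18} \<Longrightarrow> reg s' r = reg s r) \<Longrightarrow>
      (reg s' 8, reg s' 9, reg s' 10, reg s' 11, reg s' 12, reg s' 13) =
        (if reg s 7 < reg s 6 then (0, reg s 2, reg s 2, reg s 3, 3, 4)
         else (reg s 2, reg s 3, 0, reg s 2, 4, 3)) \<Longrightarrow>
      reg s' 18 = Suc (min (reg s 6) (reg s 7)) \<Longrightarrow>
      mem s' = mem s \<Longrightarrow> elapsed s' = elapsed s + 9 \<Longrightarrow> Q s'"
  shows "wp choose_prog s Q"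
  unfolding choose_prog_def
  apply (rule wp_Seq, rule wp_basic, rule wp_IfNZ)
   apply (rule wp_Seq, rule wp_basic, simp add: const)+
   apply (rule wp_basic, rule Q)
       apply (simp_all add: const)[5]
  apply (rule wp_Seq, rule wp_basic, simp add: const)+
  apply (rule wp_basic, rule Q)
  by (simp_all add: const)

lemma wp_rounds_prog:
  assumes "reg s 3 > 0"
    and Q: "\<And>s'. (\<And>r. r < 20 \<Longrightarrow> r \<notin> {16, 17, 18} \<Longrightarrow> reg s' r = reg s r) \<Longrightarrow>
      reg s' 17 = 3 * reg s 18 * (ceil_div (reg s 16) (reg s 3) - 5) \<Longrightarrow>
      mem s' = mem s \<Longrightarrow>
      elapsed s' = elapsed s + 3 * ceil_div (reg s 16) (reg s 3) + 9 \<Longrightarrow> Q s'"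
  shows "wp rounds_prog s Q"
proof -
  have eq: "c * (d + (d + d)) - (d + (d + d) + (d + (d + d)) + (d + (d + d)) + (d + (d + d)) +
    (d + (d + d))) = 3 * d * (c - 5)" for c d :: nat
    by (simp add: algebra_simps diff_mult_distrib2)
  show ?thesis unfolding rounds_prog_def
    apply (rule wp_Seq, rule wp_basic, simp)+
    apply (rule wp_Seq)
    apply (rule wp_ceil_div_prog)
        apply (simp_all add: assms(1))
    apply (rule wp_Seq, rule wp_basic, simp)+
    apply (rule wp_basic, rule Q)
    by (simp_all add: eq)
qed

lemma nth_graph_input:
  "graph_input as bs es ! 0 = length as" "graph_input as bs es ! 1 = length bs"
  "graph_input as bs es ! 2 = length es"
  "j < length es \<Longrightarrow> graph_input as bs es ! (3 + 2 * j) = fst (es ! j)"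
  "j < length es \<Longrightarrow> graph_input as bs es ! (4 + 2 * j) = snd (es ! j)"
  "length (graph_input as bs es) = 3 + 2 * length es"
  using nth_concat_map_pairs[of j es]
  by (simp_all add: graph_input_def length_concat_map_pairs numeral_eq_Suc)

text \<open>The degree counters lie below \<open>T\<close>, so the table still consists of zeros
  after the setup. The constant 38 collects 14 for the initialisation, 3 and 3 for the loops over
  edges and divisors, and 9 and 9 for the last two parts.\<close>

lemma wp_setup_prog:
  fixes as bs :: "'v list" and es :: "(nat \<times> nat) list"
  defines "dA \<equiv> max_occurrences (\<lambda>j. fst (es ! j)) (length es)"
    and "dB \<equiv> max_occurrences (\<lambda>j. snd (es ! j)) (length es)"
    and "T \<equiv> 3 + 2 * length es + length as + length bs"
  assumes es: "set es \<subseteq> {..<length as} \<times> {..<length bs}" and "0 < length bs"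
    and Q: "\<And>s'. reg s' 0 = T \<Longrightarrow> reg s' 1 = length as + length bs \<Longrightarrow> reg s' 4 = length es \<Longrightarrow>
      reg s' 5 = 1 \<Longrightarrow> reg s' 14 = 2 * (length as + length bs) \<Longrightarrow> reg s' 15 = T \<Longrightarrow>
      reg s' 19 = 0 \<Longrightarrow>
      (reg s' 8, reg s' 9, reg s' 10, reg s' 11, reg s' 12, reg s' 13) =
        (if dB < dA then (0, length as, length as, length bs, 3, 4)
         else (length as, length bs, 0, length as, 4, 3)) \<Longrightarrow>
      reg s' 17 = 3 * Suc (min dA dB) * (rounds (length bs) - 5) \<Longrightarrow>
      (\<And>j. j < length es \<Longrightarrow> mem s' (3 + 2 * j) = fst (es ! j)) \<Longrightarrow>
      (\<And>j. j < length es \<Longrightarrow> mem s' (4 + 2 * j) = snd (es ! j)) \<Longrightarrow>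
      (\<And>a. T \<le> a \<Longrightarrow> mem s' a = 0) \<Longrightarrow>
      elapsed s' = 38 + 18 * length es + 4 * length bs +
        3 * (\<Sum>i=1..length bs. ceil_div (length bs) i) + 3 * rounds (length bs) \<Longrightarrow> Q s'"
  shows "wp setup_prog (initial_state (graph_input as bs es)) Q"
proof -
  define s where "s = initial_state (graph_input as bs es)"
  have cong: "max_occurrences f e = max_occurrences g e \<and> occurrences f e = occurrences g e"
    if "\<And>j. j < e \<Longrightarrow> f j = g j" for f g e
    using that by (induction e) (auto simp: fun_eq_iff)
  have s: "\<And>r. reg s r = 0" "mem s 0 = length as" "mem s 1 = length bs" "mem s 2 = length es"
    "\<And>j. j < length es \<Longrightarrow> mem s (3 + 2 * j) = fst (es ! j)"
    "\<And>j. j < length es \<Longrightarrow> mem s (4 + 2 * j) = snd (es ! j)"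
    "\<And>a. 3 + 2 * length es \<le> a \<Longrightarrow> mem s a = 0" "elapsed s = 0"
    using nth_graph_input[where as = as and bs = bs and es = es] by (auto simp: s_def initial_state_def simp del: One_nat_def)
  note s' = s(2-4)[unfolded One_nat_def]
  have d: "max_occurrences (\<lambda>j. mem s (3 + 2 * j)) (length es) = dA"
    "max_occurrences (\<lambda>j. mem s (4 + 2 * j)) (length es) = dB"
    using s(5,6) unfolding dA_def dB_def by (intro cong[THEN conjunct1]; simp)+
  have range: "fst (es ! j) < length as" "snd (es ! j) < length bs" if "j < length es" for j
    using es nth_mem[OF that] by auto
  show ?thesis unfolding setup_prog_def s_def[symmetric]
    apply (rule wp_Seq)
    apply (rule wp_init_prog)
     apply (simp add: s)
    apply (rule wp_Seq)
    apply (rule wp_degree_prog)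
             apply (simp_all add: s s' range)[9]
    apply (rule wp_Seq)
    apply (rule wp_harmonic_prog)
      apply (simp_all add: s s')[2]
    apply (rule wp_Seq)
    apply (rule wp_choose_prog)
      apply (simp_all add: s s')[2]
    apply (rule wp_rounds_prog)
     apply (use \<open>0 < length bs\<close> in \<open>simp add: s s'\<close>)
    apply (rule Q)
    by (simp_all add: s s' d T_def rounds_def)
qed

section \<open>Rows of the table\<close>

definition bit_row_prog :: "nat \<Rightarrow> nat \<Rightarrow> prog" where
  "bit_row_prog lo len = bits_prog ;; fill_prog lo len 1 ;; Add 15 15 1"

text \<open>\<open>S\<close> is the side held at \<open>n\<close>, within reach of both 0 and 2 n;
  the row separates vertices outside \<open>S\<close>. With a power of two for \<open>w\<close> the
  parity is a binary digit.\<close>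

definition bit_row :: "nat \<Rightarrow> nat set \<Rightarrow> nat \<Rightarrow> nat \<Rightarrow> nat" where
  "bit_row n S w v = (if v \<in> S then n else if odd (v div w) then 2 * n else 0)"

lemma wp_bit_row_prog:
  assumes regs: "lo < 15" "len < 15"
    and const: "reg s 5 = 1" "reg s 19 = 0" "reg s 14 = 2 * reg s 1" and w: "reg s 16 > 0"
    and S: "S = {reg s lo..<reg s lo + reg s len}" "S \<subseteq> {..<reg s 1}"
    and Q: "\<And>s'. (\<And>r. r < 20 \<Longrightarrow> r \<noteq> 15 \<Longrightarrow> reg s' r = reg s r) \<Longrightarrow>
      reg s' 15 = reg s 15 + reg s 1 \<Longrightarrow>
      (\<And>v. v < reg s 1 \<Longrightarrow> mem s' (reg s 15 + v) = bit_row (reg s 1) S (reg s 16) v) \<Longrightarrow>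
      (\<And>a. a < reg s 15 \<or> reg s 15 + reg s 1 \<le> a \<Longrightarrow> mem s' a = mem s a) \<Longrightarrow>
      elapsed s' \<le> elapsed s + 12 * reg s 1 + 9 \<Longrightarrow> Q s'"
  shows "wp (bit_row_prog lo len) s Q"
proof -
  \<comment> \<open>If the side is empty, \<open>S\<close> says nothing about its offset, so the
    inequality is stated for nonempty sides only.\<close>
  have len: "reg s lo + reg s len \<le> reg s 1" if "reg s len > 0"
  proof -
    have "reg s lo + reg s len - 1 \<in> S" using that by (auto simp: S)
    then show ?thesis using S(2) by auto
  qed
  have len': "reg s len \<le> reg s 1" using len by (cases "reg s len = 0") auto
  show ?thesis unfolding bit_row_prog_def
    apply (rule wp_Seq)
    apply (rule wp_bits_prog)
        apply (simp_all add: const w)[4]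
    apply (rule wp_Seq)
    apply (rule wp_fill_prog)
         apply (use regs in \<open>simp_all add: const\<close>)[5]
    apply (rule wp_basic, rule Q)
    subgoal using regs by simp
    subgoal using regs by simp
    subgoal using regs len by (auto simp: bit_row_def S)
    subgoal for s1 s2 a using regs len by (cases "reg s len = 0") auto
    subgoal using regs len' by simp
    done
qed

text \<open>Doubling continues while the power of two is below \<open>n\<close>, so the number of
  digits never has to be computed.\<close>

definition bit_rows_prog :: prog where
  "bit_rows_prog = Const 16 1 ;; Sub 20 1 16 ;;
     WhileNZ 20 (bit_row_prog 8 9 ;; bit_row_prog 10 11 ;; Add 16 16 16 ;; Sub 20 1 16)"

text \<open>The two conditions on \<open>K\<close> make it the least exponent with n \<le> 2 ^ K,
  which is when the loop stops. Even rows hold \<open>X\<close> at \<open>n\<close> and thus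
  separate vertices of \<open>Y\<close>; odd rows do the converse.\<close>

lemma wp_bit_rows_prog:
  fixes s :: state
  defines "n \<equiv> reg s 1" and "T \<equiv> reg s 15"
  assumes const: "reg s 5 = 1" "reg s 19 = 0" "reg s 14 = 2 * reg s 1"
    and S: "X = {reg s 8..<reg s 8 + reg s 9}" "Y = {reg s 10..<reg s 10 + reg s 11}"
      "X \<subseteq> {..<n}" "Y \<subseteq> {..<n}"
    and K: "n \<le> 2 ^ K" "\<And>j. j < K \<Longrightarrow> 2 ^ j < n"
    and Q: "\<And>s'. (\<And>r. r < 20 \<Longrightarrow> r \<noteq> 15 \<Longrightarrow> r \<noteq> 16 \<Longrightarrow> reg s' r = reg s r) \<Longrightarrow>
      reg s' 15 = T + 2 * K * n \<Longrightarrow>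
      (\<And>j v. j < K \<Longrightarrow> v < n \<Longrightarrow> mem s' (T + 2 * j * n + v) = bit_row n X (2 ^ j) v) \<Longrightarrow>
      (\<And>j v. j < K \<Longrightarrow> v < n \<Longrightarrow> mem s' (T + (2 * j + 1) * n + v) = bit_row n Y (2 ^ j) v) \<Longrightarrow>
      (\<And>a. a < T \<or> T + 2 * K * n \<le> a \<Longrightarrow> mem s' a = mem s a) \<Longrightarrow>
      elapsed s' \<le> elapsed s + 3 + K * (24 * n + 21) \<Longrightarrow> Q s'"
  shows "wp bit_rows_prog s Q"
proof -
  define I where "I j s' \<longleftrightarrow> (\<forall>r<20. r \<noteq> 15 \<longrightarrow> r \<noteq> 16 \<longrightarrow> reg s' r = reg s r) \<and>
    reg s' 15 = T + 2 * j * n \<and> reg s' 16 = 2 ^ j \<and> reg s' 20 = n - 2 ^ j \<and>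
    (\<forall>i v. i < j \<longrightarrow> v < n \<longrightarrow> mem s' (T + 2 * i * n + v) = bit_row n X (2 ^ i) v) \<and>
    (\<forall>i v. i < j \<longrightarrow> v < n \<longrightarrow> mem s' (T + (2 * i + 1) * n + v) = bit_row n Y (2 ^ i) v) \<and>
    (\<forall>a. a < T \<or> T + 2 * j * n \<le> a \<longrightarrow> mem s' a = mem s a) \<and>
    elapsed s' \<le> elapsed s + 2 + j * (24 * n + 21)" for j and s' :: state
  show ?thesis unfolding bit_rows_prog_def
    apply (intro wp_Seq wp_basic)
    apply (rule wp_While[where I = I and N = K])
    subgoal by (simp add: I_def n_def T_def)
    subgoal for j s'
    proof (rule conjI, goal_cases)
      case 1
      then show ?case using K(2)[of j] by (simp add: I_def)
    next
      case 2
      have I: "\<And>r. r < 20 \<Longrightarrow> r \<noteq> 15 \<Longrightarrow> r \<noteq> 16 \<Longrightarrow> reg s' r = reg s r"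
        "reg s' 15 = T + 2 * j * n" "reg s' 16 = 2 ^ j"
        "\<And>i v. i < j \<Longrightarrow> v < n \<Longrightarrow> mem s' (T + 2 * i * n + v) = bit_row n X (2 ^ i) v"
        "\<And>i v. i < j \<Longrightarrow> v < n \<Longrightarrow> mem s' (T + (2 * i + 1) * n + v) = bit_row n Y (2 ^ i) v"
        "\<And>a. a < T \<or> T + 2 * j * n \<le> a \<Longrightarrow> mem s' a = mem s a"
        "elapsed s' \<le> elapsed s + 2 + j * (24 * n + 21)"
        using 2(2) by (simp_all add: I_def) (erule disjE; simp)
      have below: "2 * i * n + v < 2 * j * n" "(2 * i + 1) * n + v < 2 * j * n"
        if "i < j" "v < n" for i v
      proof -
        have "(2 * i + 1 + 1) * n \<le> 2 * j * n" using that by (intro mult_right_mono) auto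
        then show "2 * i * n + v < 2 * j * n" "(2 * i + 1) * n + v < 2 * j * n"
          using that by (auto simp: algebra_simps)
      qed
      have step: "I (Suc j) s4" if
        s2: "mem s2 = mem s1'" "mem s4 = mem s2'"
        "\<And>v. v < n \<Longrightarrow> mem s1' (T + 2 * j * n + v) = bit_row n X (2 ^ j) v"
        "\<And>v. v < n \<Longrightarrow> mem s2' (T + 2 * j * n + n + v) = bit_row n Y (2 ^ j) v"
        "\<And>a. a < T + 2 * j * n \<or> T + 2 * j * n + n \<le> a \<Longrightarrow> mem s1' a = mem s' a"
        "\<And>a. a < T + 2 * j * n + n \<or> T + 2 * j * n + n + n \<le> a \<Longrightarrow> mem s2' a = mem s2 a"
        "\<And>r. r < 20 \<Longrightarrow> r \<noteq> 15 \<Longrightarrow> r \<noteq> 16 \<Longrightarrow> reg s4 r = reg s r"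
        "reg s4 15 = T + 2 * j * n + n + n" "reg s4 16 = 2 ^ j + 2 ^ j" "reg s4 20 = n - (2 ^ j + 2 ^ j)"
        "elapsed s4 \<le> elapsed s' + 24 * n + 21" for s1' s2 s2' s4
      proof -
        have A: "mem s4 (T + 2 * i * n + v) = bit_row n X (2 ^ i) v" if "i < Suc j" "v < n" for i v
        proof (cases "i = j")
          case True
          then show ?thesis using s2(1-6) that by simp
        next
          case False
          then have "i < j" using that by simp
          then show ?thesis using s2(1,2,5,6) that below[of i v] I(4)[of i v] by (simp add: add.assoc)
        qed
        have B: "mem s4 (T + (2 * i + 1) * n + v) = bit_row n Y (2 ^ i) v" if "i < Suc j" "v < n" for i v
        proof (cases "i = j")
          case True
          have "T + (2 * j + 1) * n + v = T + 2 * j * n + n + v" by (simp add: algebra_simps)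
          then show ?thesis unfolding True s2(2) using s2(4)[OF that(2)] by (simp only:)
        next
          case False
          then have "i < j" using that by simp
          then show ?thesis using s2(1,2,5,6) that below[of i v] I(5)[of i v] by (simp add: add.assoc)
        qed
        have C: "mem s4 a = mem s a" if "a < T \<or> T + 2 * Suc j * n \<le> a" for a
          using s2(1,2,5,6) I(6)[of a] that by (auto simp: algebra_simps)
        show ?thesis unfolding I_def
          using A B C s2(7-11) I(7) by (auto simp: algebra_simps)
      qed
      show ?case
        apply (rule wp_Seq)
        apply (rule wp_bit_row_prog[where S = X])
               apply (simp_all add: I const S(1))[6]
         apply (use S in \<open>simp_all add: I n_def\<close>)[2]
        apply (rule wp_Seq)
        apply (rule wp_bit_row_prog[where S = Y])
               apply (simp_all add: I const S(1))[6]
         apply (use S in \<open>simp_all add: I n_def\<close>)[2]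
        subgoal for s1 s2
          apply (rule wp_Seq, rule wp_basic, rule wp_basic)
          apply (rule step[of s1 s1 _ s2])
          by (simp_all add: I n_def)
        done
    qed
    subgoal using K unfolding I_def by (intro conjI, simp) (rule Q, simp_all add: n_def, erule disjE; simp)
    done
qed

section \<open>The first element of a set under a random permutation\<close>

text \<open>Exchanging the entries at \<open>x\<close> and \<open>y\<close> is an involution on
  permutations that turns those in which \<open>x\<close> comes first in \<open>S\<close> into those
  in which \<open>y\<close> does.\<close>

lemma card_permutations_first_le:
  assumes "x < n" "y < n" "x \<in> S" "y \<in> S" "S \<subseteq> {..<n}"
  shows "card {xs \<in> permutations_of_set {0..<n}. \<forall>z\<in>S. xs ! x \<le> xs ! z}
       \<le> card {xs \<in> permutations_of_set {0..<n}. \<forall>z\<in>S. xs ! y \<le> xs ! z}"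
proof (rule card_inj_on_le)
  let ?swap = "\<lambda>xs. xs[x := xs ! y, y := xs ! x]"
  have len: "length xs = n" if "xs \<in> permutations_of_set {0..<n}" for xs
    using that by (metis card_atLeastLessThan diff_zero length_finite_permutations_of_set)
  have perm: "?swap xs \<in> permutations_of_set {0..<n}" if "xs \<in> permutations_of_set {0..<n}" for xs
  proof -
    have "mset (?swap xs) = mset xs" using len[OF that] assms by (intro mset_swap) auto
    then show ?thesis using that
      by (metis (no_types, lifting) mset_eq_imp_distinct_iff permutations_of_setD(1)
          permutations_of_setD(2) permutations_of_setI set_mset_mset)
  qed
  show "inj_on ?swap {xs \<in> permutations_of_set {0..<n}. \<forall>z\<in>S. xs ! x \<le> xs ! z}"
  proof (rule inj_on_inverseI[of _ ?swap])
    fix xs assume "xs \<in> {xs \<in> permutations_of_set {0..<n}. \<forall>z\<in>S. xs ! x \<le> xs ! z}"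
    then have "length xs = n" using len by blast
    then show "?swap (?swap xs) = xs" using assms
      by (intro nth_equalityI) (auto simp: nth_list_update)
  qed
  show "?swap ` {xs \<in> permutations_of_set {0..<n}. \<forall>z\<in>S. xs ! x \<le> xs ! z}
    \<subseteq> {xs \<in> permutations_of_set {0..<n}. \<forall>z\<in>S. xs ! y \<le> xs ! z}"
  proof clarify
    fix xs assume xs: "xs \<in> permutations_of_set {0..<n}" "\<forall>z\<in>S. xs ! x \<le> xs ! z"
    have "?swap xs ! y \<le> ?swap xs ! z" if "z \<in> S" for z
      using that \<open>S \<subseteq> {..<n}\<close> xs(2) len[OF xs(1)] assms \<open>y \<in> S\<close> \<open>x \<in> S\<close> by (auto simp: nth_list_update)
    then show "?swap xs \<in> permutations_of_set {0..<n} \<and> (\<forall>z\<in>S. ?swap xs ! y \<le> ?swap xs ! z)"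
      using perm[OF xs(1)] by blast
  qed
qed auto

text \<open>Some element of \<open>insert x N\<close> comes first in each permutation, and by
  symmetry none does so more often than \<open>x\<close>. Hence \<open>x\<close> comes first in at
  least one of d + 1 permutations. Covering instead of exact counting allows \<open>N\<close> to be
  smaller than \<open>d\<close>.\<close>

lemma prob_permutation_not_first:
  assumes "N \<subseteq> {..<n}" "x < n" "x \<notin> N" "card N \<le> d"
  shows "measure_pmf.prob (pmf_of_set (permutations_of_set {0..<n})) {xs. \<exists>z\<in>N. xs ! z \<le> xs ! x}
    \<le> real d / (real d + 1)"
proof -
  let ?P = "permutations_of_set {0..<n}"
  define S where "S = insert x N"
  define M where "M y = {xs \<in> ?P. \<forall>z\<in>S. xs ! y \<le> xs ! z}" for y
  have fin: "finite N" using assms(1) finite_subset by blast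
  have S: "S \<subseteq> {..<n}" "x \<in> S" "finite S" "card S \<le> d + 1" using assms fin by (auto simp: S_def)
  have P: "?P \<noteq> {}" "finite ?P" by auto
  have "?P \<subseteq> (\<Union>y\<in>S. M y)"
  proof
    fix xs assume xs: "xs \<in> ?P"
    have "Min ((!) xs ` S) \<in> (!) xs ` S" using S by (intro Min_in) auto
    then obtain y where "y \<in> S" "xs ! y = Min ((!) xs ` S)" by auto
    then show "xs \<in> (\<Union>y\<in>S. M y)" using xs S(3) by (auto simp: M_def intro!: bexI[of _ y])
  qed
  then have "card ?P \<le> card (\<Union>y\<in>S. M y)"
    using S(3) by (intro card_mono finite_UN_I) (auto simp: M_def)
  also have "\<dots> \<le> (\<Sum>y\<in>S. card (M y))" using S(3) by (intro card_UN_le)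
  also have "\<dots> \<le> (\<Sum>y\<in>S. card (M x))"
    unfolding M_def using S by (intro sum_mono card_permutations_first_le) auto
  also have "\<dots> \<le> (d + 1) * card (M x)" using S(4) by (simp del: mult_Suc add: mult_right_mono)
  finally have le: "real (card ?P) \<le> (real d + 1) * real (card (M x))"
    by (metis of_nat_1 of_nat_add of_nat_le_iff of_nat_mult)
  \<comment> \<open>Entries of a permutation are distinct, so a neighbour that is not after
    \<open>x\<close> is strictly before it.\<close>
  have disj: "?P \<inter> {xs. \<exists>z\<in>N. xs ! z \<le> xs ! x} \<subseteq> ?P - M x"
  proof
    fix xs assume "xs \<in> ?P \<inter> {xs. \<exists>z\<in>N. xs ! z \<le> xs ! x}"
    then obtain z where z: "xs \<in> ?P" "z \<in> N" "xs ! z \<le> xs ! x" by auto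
    have "length xs = n"
      using z(1) by (metis card_atLeastLessThan diff_zero length_finite_permutations_of_set)
    then have "xs ! z \<noteq> xs ! x"
      using z assms by (metis lessThan_iff nth_eq_iff_index_eq permutations_of_setD(2) subsetD)
    then show "xs \<in> ?P - M x" using z by (auto simp: M_def S_def intro!: bexI[of _ z])
  qed
  have "card (?P \<inter> {xs. \<exists>z\<in>N. xs ! z \<le> xs ! x}) \<le> card (?P - M x)"
    by (intro card_mono disj) auto
  also have "\<dots> = card ?P - card (M x)" by (intro card_Diff_subset) (auto simp: M_def)
  finally have "card (?P \<inter> {xs. \<exists>z\<in>N. xs ! z \<le> xs ! x}) + card (M x) \<le> card ?P"
    using card_mono[of ?P "M x"] unfolding M_def by (simp del: card_permutations_of_set)
  then have "real (card (?P \<inter> {xs. \<exists>z\<in>N. xs ! z \<le> xs ! x})) \<le> real (card ?P) - real (card (M x))"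
    by (simp only: of_nat_add[symmetric] of_nat_le_iff le_diff_eq)
  also have "\<dots> \<le> real d / (real d + 1) * card ?P" using le by (simp add: field_simps)
  finally show ?thesis using P
    by (subst measure_pmf_of_set) (auto simp: divide_simps card_gt_0_iff add.commute)
qed

lemma yields_unique: "yields p s D \<Longrightarrow> yields p s D' \<Longrightarrow> D = D'"
proof -
  assume "yields p s D" "yields p s D'"
  then have "\<forall>\<^sub>F f in sequentially. exec f p s = map_pmf Some D \<and> exec f p s = map_pmf Some D'"
    unfolding yields_def by (intro eventually_conj) blast+
  then have "\<exists>f. exec f p s = map_pmf Some D \<and> exec f p s = map_pmf Some D'"
    by (rule eventually_happens'[rotated]) simp
  then have "map_pmf Some D = map_pmf Some D'" by metis
  then show "D = D'" by (rule injD[OF pmf.inj_map[OF inj_Some]])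
qed

text \<open>The remaining program is described only by a relation \<open>R\<close> between the
  permutation and the final state. An event \<open>S\<close> of final states is then at most as
  likely as any set \<open>Z\<close> of permutations that contains every permutation able to lead to
  \<open>S\<close>.\<close>

lemma yields_RandPerm_Seq:
  fixes s :: state and r x :: nat
  defines "P \<equiv> permutations_of_set {0..<reg s x}"
  assumes wp: "\<And>xs. xs \<in> P \<Longrightarrow> wp q (charge (reg s x + 1) (write_list (reg s r) xs s)) (R xs)"
  shows "\<exists>D. yields (RandPerm r x ;; q) s D \<and> (\<forall>s'\<in>set_pmf D. \<exists>xs\<in>P. R xs s') \<and>
    (\<forall>S Z. (\<forall>xs\<in>P. \<forall>s'\<in>S. R xs s' \<longrightarrow> xs \<in> Z) \<longrightarrow>
      measure_pmf.prob D S \<le> measure_pmf.prob (pmf_of_set P) Z)"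
proof -
  let ?f = "\<lambda>xs. charge (reg s x + 1) (write_list (reg s r) xs s)"
  have P: "finite P" "P \<noteq> {}" by (auto simp: P_def)
  have setP: "set_pmf (pmf_of_set P) = P" using P by simp
  have "\<forall>xs\<in>P. \<exists>D. yields q (?f xs) D \<and> (\<forall>s'\<in>set_pmf D. R xs s')"
    using wp by (auto simp: wp_def)
  from bchoice[OF this] obtain G
    where G: "\<forall>xs\<in>P. yields q (?f xs) (G xs) \<and> (\<forall>s'\<in>set_pmf (G xs). R xs s')" ..
  \<comment> \<open>A continuation must be a function of the state, whereas \<open>G\<close> depends
    on the permutation. By \<open>yields_unique\<close> the two agree on the states that
    arise.\<close>
  define F where "F s1 = (SOME D. yields q s1 D)" for s1
  have F: "yields q (?f xs) (F (?f xs))" if "xs \<in> P" for xs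
    unfolding F_def using bspec[OF G that] someI[of "yields q (?f xs)"] by fast
  have FG: "F (?f xs) = G xs" if "xs \<in> P" for xs
    using yields_unique[OF F[OF that]] bspec[OF G that] by fast
  let ?D = "bind_pmf (pmf_of_set P) G"
  have "bind_pmf (map_pmf ?f (pmf_of_set P)) F = ?D"
    unfolding bind_map_pmf using FG by (intro bind_pmf_cong) (auto simp: setP)
  moreover have "yields (RandPerm r x ;; q) s (bind_pmf (map_pmf ?f (pmf_of_set P)) F)"
    unfolding P_def using F by (intro yields_Seq yields_RandPerm) (auto simp: P_def)
  ultimately have "yields (RandPerm r x ;; q) s ?D" by simp
  moreover have "measure_pmf.prob ?D S \<le> measure_pmf.prob (pmf_of_set P) Z * 1"
    if "\<forall>xs\<in>P. \<forall>s'\<in>S. R xs s' \<longrightarrow> xs \<in> Z" for S Z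
    using that G by (intro prob_bind_pmf_le[where T = Z]) (auto simp: setP)
  moreover have "\<exists>xs\<in>P. R xs s'" if "s' \<in> set_pmf ?D" for s'
    using that G unfolding set_bind_pmf setP by blast
  ultimately show ?thesis by (intro exI[of _ ?D]) auto
qed

section \<open>Random rows\<close>

text \<open>Two intervals of length \<open>n\<close> with lower ends \<open>a\<close> and
  \<open>b\<close> meet. Both inequalities are written with additions to stay clear of truncated
  subtraction.\<close>

definition close :: "nat \<Rightarrow> nat \<Rightarrow> nat \<Rightarrow> bool" where
  "close n a b \<longleftrightarrow> a \<le> b + n \<and> b \<le> a + n"

text \<open>\<open>x j\<close> and \<open>y j\<close> are the ends in \<open>X\<close> and in \<open>Y\<close> of the \<open>j\<close>-th edge, as vertex numbers.\<close>

definition layout ::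
  "nat \<Rightarrow> nat \<Rightarrow> nat set \<Rightarrow> nat set \<Rightarrow> (nat \<Rightarrow> nat) \<Rightarrow> (nat \<Rightarrow> nat) \<Rightarrow> state \<Rightarrow> bool" where
  "layout n m X Y x y s \<longleftrightarrow>
     reg s 1 = n \<and> reg s 4 = m \<and> reg s 5 = 1 \<and> reg s 14 = 2 * n \<and> reg s 19 = 0 \<and>
     X = {reg s 8..<reg s 8 + reg s 9} \<and> Y = {reg s 10..<reg s 10 + reg s 11} \<and>
     X \<inter> Y = {} \<and> X \<union> Y = {..<n} \<and>
     (\<forall>j<m. reg s 12 + 2 * j < reg s 15 \<and> x j = reg s 8 + mem s (reg s 12 + 2 * j) \<and> x j \<in> X \<and>
       reg s 13 + 2 * j < reg s 15 \<and> y j = reg s 10 + mem s (reg s 13 + 2 * j) \<and> y j \<in> Y)"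

text \<open>Memory enters \<open>layout\<close> only through the edge list, which lies below the
  current row. Writing rows and advancing the row pointer therefore preserve it.\<close>

lemma layout_cong:
  assumes "layout n m X Y x y s" "\<And>r. r < 20 \<Longrightarrow> r \<notin> {15, 16, 17} \<Longrightarrow> reg s' r = reg s r"
    "reg s 15 \<le> reg s' 15" "\<And>a. a < reg s 15 \<Longrightarrow> mem s' a = mem s a"
  shows "layout n m X Y x y s'"
proof -
  have e: "reg s' 1 = reg s 1" "reg s' 4 = reg s 4" "reg s' 5 = reg s 5" "reg s' 8 = reg s 8"
    "reg s' 9 = reg s 9" "reg s' 10 = reg s 10" "reg s' 11 = reg s 11" "reg s' 12 = reg s 12"
    "reg s' 13 = reg s 13" "reg s' 14 = reg s 14" "reg s' 19 = reg s 19"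
    by (simp_all add: assms(2))
  have "reg s 12 + 2 * j < reg s' 15 \<and> x j = reg s 8 + mem s' (reg s 12 + 2 * j) \<and> x j \<in> X \<and>
       reg s 13 + 2 * j < reg s' 15 \<and> y j = reg s 10 + mem s' (reg s 13 + 2 * j) \<and> y j \<in> Y"
    if "j < m" for j
  proof -
    have "reg s 12 + 2 * j < reg s 15 \<and> x j = reg s 8 + mem s (reg s 12 + 2 * j) \<and> x j \<in> X \<and>
       reg s 13 + 2 * j < reg s 15 \<and> y j = reg s 10 + mem s (reg s 13 + 2 * j) \<and> y j \<in> Y"
      using assms(1) that unfolding layout_def by blast
    then show ?thesis
      using assms(3) assms(4)[of "reg s 12 + 2 * j"] assms(4)[of "reg s 13 + 2 * j"] by auto
  qed
  then show ?thesis using assms(1) unfolding layout_def e by blast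
qed

lemma layout_charge [simp]: "layout n m X Y x y (charge t s) = layout n m X Y x y s"
  by (simp add: layout_def)

text \<open>The permutation covers all vertices, and the cells of \<open>Y\<close> are then
  overwritten by 2 n. This value exceeds n + \<pi> x for every \<open>x\<close>, so it is neutral
  for the running minimum and also correct for a vertex without neighbours.\<close>

definition random_row_prog :: prog where
  "random_row_prog = RandPerm 15 1 ;; fill_prog 10 11 14 ;; relax_prog ;; Add 15 15 1 ;;
     Sub 17 17 5"

text \<open>For an edge, the end in \<open>X\<close> lies below \<open>n\<close> and the end in
  \<open>Y\<close> between \<open>n\<close> and \<open>n\<close> plus the position of the former, so
  they are close with certainty. The degree premise counts distinct neighbours, which is what the
  bound for permutations needs.\<close>

lemma yields_random_row_prog:
  fixes s :: state
  defines "T \<equiv> reg s 15"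
  assumes layout: "layout n m X Y x y s"
    and degree: "\<And>v. v \<in> Y \<Longrightarrow> card (x ` {j. j < m \<and> y j = v}) \<le> d"
  shows "\<exists>D. yields random_row_prog s D \<and>
    (\<forall>s'\<in>set_pmf D. (\<forall>r<20. r \<noteq> 15 \<longrightarrow> r \<noteq> 17 \<longrightarrow> reg s' r = reg s r) \<and>
      reg s' 15 = T + n \<and> reg s' 17 = reg s 17 - 1 \<and>
      (\<forall>a. a < T \<or> T + n \<le> a \<longrightarrow> mem s' a = mem s a) \<and>
      (\<forall>j<m. close n (mem s' (T + x j)) (mem s' (T + y j))) \<and>
      elapsed s' \<le> elapsed s + 5 * n + 16 * m + 12) \<and>
    (\<forall>u\<in>X. \<forall>v\<in>Y. (\<forall>j<m. x j = u \<longrightarrow> y j \<noteq> v) \<longrightarrow>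
      measure_pmf.prob D {s'. close n (mem s' (T + u)) (mem s' (T + v))} \<le> real d / (real d + 1))"
proof -
  have L: "reg s 1 = n" "reg s 4 = m" "reg s 5 = 1" "reg s 14 = 2 * n" "reg s 19 = 0"
    "X = {reg s 8..<reg s 8 + reg s 9}" "Y = {reg s 10..<reg s 10 + reg s 11}"
    "X \<inter> Y = {}" "X \<union> Y = {..<n}"
    "\<And>j. j < m \<Longrightarrow> reg s 12 + 2 * j < T" "\<And>j. j < m \<Longrightarrow> reg s 13 + 2 * j < T"
    "\<And>j. j < m \<Longrightarrow> reg s 8 + mem s (reg s 12 + 2 * j) = x j" "\<And>j. j < m \<Longrightarrow> x j \<in> X"
    "\<And>j. j < m \<Longrightarrow> reg s 10 + mem s (reg s 13 + 2 * j) = y j" "\<And>j. j < m \<Longrightarrow> y j \<in> Y"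
    using layout by (auto simp: layout_def T_def)
  let ?P = "permutations_of_set {0..<n}"
  have XY: "\<And>v. v \<in> X \<Longrightarrow> v < n" "\<And>v. v \<in> Y \<Longrightarrow> v < n" "\<And>v. v \<in> Y \<Longrightarrow> v \<notin> X"
    using L(8,9) by blast+
  define R where "R xs s' \<longleftrightarrow> (\<forall>r<20. r \<noteq> 15 \<longrightarrow> r \<noteq> 17 \<longrightarrow> reg s' r = reg s r) \<and>
      reg s' 15 = T + n \<and> reg s' 17 = reg s 17 - 1 \<and>
      (\<forall>a. a < T \<or> T + n \<le> a \<longrightarrow> mem s' a = mem s a) \<and>
      (\<forall>v\<in>X. mem s' (T + v) = xs ! v) \<and>
      (\<forall>v\<in>Y. mem s' (T + v) = 2 * n \<or> (\<exists>j<m. y j = v \<and> mem s' (T + v) = n + xs ! x j)) \<and>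
      (\<forall>j<m. mem s' (T + y j) \<le> n + xs ! x j) \<and>
      elapsed s' \<le> elapsed s + 5 * n + 16 * m + 12" for xs and s' :: state
  have leny: "reg s 11 \<le> n"
  proof -
    have "card Y \<le> card {..<n}" using L(9) by (intro card_mono) auto
    then show ?thesis using L(7) by simp
  qed
  have wpR: "wp (fill_prog 10 11 14 ;; relax_prog ;; Add 15 15 1 ;; Sub 17 17 5)
      (charge (reg s 1 + 1) (write_list (reg s 15) xs s)) (R xs)" if xs: "xs \<in> ?P" for xs
  proof -
    have len: "length xs = n"
      using xs by (metis card_atLeastLessThan diff_zero length_finite_permutations_of_set)
    define s0 where "s0 = charge (reg s 1 + 1) (write_list (reg s 15) xs s)"
    have s0: "\<And>r. reg s0 r = reg s r" "elapsed s0 = elapsed s + n + 1"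
      "\<And>a. mem s0 a = (if T \<le> a \<and> a < T + n then xs ! (a - T) else mem s a)"
      using L(1) len by (simp_all add: s0_def write_list_def T_def charge_def)
    show ?thesis
      unfolding s0_def[symmetric]
      apply (rule wp_Seq)
      apply (rule wp_fill_prog)
           apply (simp_all add: s0 L(1-5))[5]
      subgoal for s1
      proof -
        assume s1: "\<And>r. r < 20 \<Longrightarrow> reg s1 r = reg s0 r"
          "mem s1 = (\<lambda>x. if reg s0 15 + reg s0 10 \<le> x \<and> x < reg s0 15 + reg s0 10 + reg s0 11
                    then reg s0 14 else mem s0 x)"
          "elapsed s1 = elapsed s0 + 4 * reg s0 11 + 3"
        have r: "\<And>r. r < 20 \<Longrightarrow> reg s1 r = reg s r" using s1(1) s0(1) by simp
        have low: "mem s1 a = mem s a" if "a < T \<or> T + n \<le> a" for a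
        proof -
          have "\<not> (reg s0 15 + reg s0 10 \<le> a \<and> a < reg s0 15 + reg s0 10 + reg s0 11)"
          proof
            assume a: "reg s0 15 + reg s0 10 \<le> a \<and> a < reg s0 15 + reg s0 10 + reg s0 11"
            then have "a - T \<in> Y" using L(7) s0(1) by (auto simp: T_def)
            then show False using XY(2)[of "a - T"] that a s0(1) by (auto simp: T_def)
          qed
          then show ?thesis using that s0(3) unfolding s1(2) by auto
        qed
        have mX: "mem s1 (T + v) = xs ! v" if "v \<in> X" for v
        proof -
          have "v \<notin> Y" using that L(8) by blast
          then show ?thesis using XY(1)[OF that] L(7) unfolding s1(2) s0 by (auto simp: T_def)
        qed
        have mY: "mem s1 (T + v) = 2 * n" if "v \<in> Y" for v
          using that L(4,7) unfolding s1(2) s0 by (auto simp: T_def)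
        have e: "T + reg s 8 + mem s1 (reg s 12 + 2 * j) = T + x j"
          "T + reg s 10 + mem s1 (reg s 13 + 2 * j) = T + y j" if "j < m" for j
          using low L(10-15) that by (simp_all add: add.assoc)
        have disj: "(\<lambda>j. T + x j) ` {..<m} \<inter> (\<lambda>j. T + y j) ` {..<m} = {}"
          using L(8,13,15) by fastforce
        have disj': "(\<lambda>j. T + reg s 8 + mem s1 (reg s 12 + 2 * j)) ` {..<m} \<inter>
           (\<lambda>j. T + reg s 10 + mem s1 (reg s 13 + 2 * j)) ` {..<m} = {}"
          using disj e by (metis (no_types, lifting) image_cong lessThan_iff)
        show ?thesis
          apply (rule wp_Seq)
          apply (rule wp_relax_prog)
          subgoal using r L(3) by simp
          subgoal using r L(5) by simp
          subgoal using r L(2,10) by (simp add: T_def)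
          subgoal using r L(2,11) by (simp add: T_def)
          subgoal using r L(2) disj' by (simp add: T_def)
          subgoal for s2
          proof -
            assume s2: "\<And>r. r < 20 \<Longrightarrow> reg s2 r = reg s1 r"
              "\<And>a. mem s2 a = mem s1 a \<or> (\<exists>j<reg s1 4.
                 a = reg s1 15 + reg s1 10 + mem s1 (reg s1 13 + 2 * j) \<and>
                 mem s2 a = reg s1 1 + mem s1 (reg s1 15 + reg s1 8 + mem s1 (reg s1 12 + 2 * j)))"
              "\<And>j. j < reg s1 4 \<Longrightarrow> mem s2 (reg s1 15 + reg s1 10 + mem s1 (reg s1 13 + 2 * j))
                \<le> reg s1 1 + mem s1 (reg s1 15 + reg s1 8 + mem s1 (reg s1 12 + 2 * j))"
              "elapsed s2 = elapsed s1 + 16 * reg s1 4 + 6"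
            have r': "reg s1 15 = T" "reg s1 1 = n" "reg s1 4 = m" "reg s1 8 = reg s 8"
              "reg s1 10 = reg s 10" "reg s1 12 = reg s 12" "reg s1 13 = reg s 13"
              using r L(1,2) by (simp_all add: T_def)
            have e': "reg s1 15 + reg s1 10 + mem s1 (reg s1 13 + 2 * j) = T + y j"
              "mem s1 (reg s1 15 + reg s1 8 + mem s1 (reg s1 12 + 2 * j)) = xs ! x j" if "j < m" for j
              unfolding r' e[OF that] using mX[OF L(13)[OF that]] by simp_all
            have m2: "mem s2 a = mem s1 a \<or> (\<exists>j<m. a = T + y j \<and> mem s2 a = n + xs ! x j)" for a
              using s2(2)[of a] e' unfolding r'(2,3) by auto
            have le: "mem s2 (T + y j) \<le> n + xs ! x j" if "j < m" for j
              using s2(3)[of j] e'[OF that] that unfolding r'(2,3) by simp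
            have A: "mem s2 a = mem s a" if "a < T \<or> T + n \<le> a" for a
              using m2[of a] low[OF that] XY(2) L(15) that by fastforce
            have B: "mem s2 (T + v) = xs ! v" if "v \<in> X" for v
              using m2[of "T + v"] mX[OF that] that L(15) XY(3) by fastforce
            have C: "mem s2 (T + v) = 2 * n \<or> (\<exists>j<m. y j = v \<and> mem s2 (T + v) = n + xs ! x j)"
              if "v \<in> Y" for v
              using m2[of "T + v"] mY[OF that] by auto
            have E: "elapsed s2 + 2 \<le> elapsed s + 5 * n + 16 * m + 12"
              using s2(4) s1(3) s0(2) leny unfolding r' s0(1) by simp
            have rr: "\<And>r. r < 20 \<Longrightarrow> reg s2 r = reg s r" using s2(1) r by simp
            show ?thesis
              apply (rule wp_Seq, rule wp_basic, rule wp_basic)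
              using A B C le E rr L(1,3) by (simp add: R_def T_def)
          qed
          done
      qed
      done
  qed
  obtain D where D: "yields random_row_prog s D" "\<And>s'. s' \<in> set_pmf D \<Longrightarrow> \<exists>xs\<in>?P. R xs s'"
    "\<And>S Z. (\<forall>xs\<in>?P. \<forall>s'\<in>S. R xs s' \<longrightarrow> xs \<in> Z) \<Longrightarrow>
      measure_pmf.prob D S \<le> measure_pmf.prob (pmf_of_set ?P) Z"
    using yields_RandPerm_Seq[of s 1 _ 15 R, unfolded L(1), OF wpR[unfolded L(1)]]
    unfolding random_row_prog_def by blast
  have lt: "xs ! v < n" if "xs \<in> ?P" "v < n" for xs v
  proof -
    have "length xs = n"
      using that(1) by (metis card_atLeastLessThan diff_zero length_finite_permutations_of_set)
    then have "xs ! v \<in> set xs" using that(2) by simp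
    then show ?thesis using permutations_of_setD(1)[OF that(1)] by simp
  qed
  have edges: "close n (mem s' (T + x j)) (mem s' (T + y j))"
    if "xs \<in> ?P" "R xs s'" "j < m" for xs s' j
  proof -
    have X: "mem s' (T + x j) = xs ! x j" "mem s' (T + y j) \<le> n + xs ! x j"
      using that L(13) by (auto simp: R_def)
    have "n \<le> mem s' (T + y j)" using that L(15) by (fastforce simp: R_def)
    then show ?thesis using X lt[OF that(1) XY(1)[OF L(13)[OF that(3)]]] by (simp add: close_def)
  qed
  have "measure_pmf.prob D {s'. close n (mem s' (T + u)) (mem s' (T + v))} \<le> real d / (real d + 1)"
    if uv: "u \<in> X" "v \<in> Y" and nonadj: "\<forall>j<m. x j = u \<longrightarrow> y j \<noteq> v" for u v
  proof -
    define N where "N = x ` {j. j < m \<and> y j = v}"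
    \<comment> \<open>Closeness rules out the value 2 n, as \<open>u\<close> lies below
      \<open>n\<close>. So the cell of \<open>v\<close> comes from a neighbour, and that neighbour
      is not after \<open>u\<close>.\<close>
    have "xs \<in> {xs. \<exists>z\<in>N. xs ! z \<le> xs ! u}"
      if "xs \<in> ?P" "R xs s'" "close n (mem s' (T + u)) (mem s' (T + v))" for xs s'
    proof -
      have "mem s' (T + v) \<le> xs ! u + n" using that(2,3) uv by (auto simp: R_def close_def)
      moreover have "mem s' (T + v) = 2 * n \<or> (\<exists>j<m. y j = v \<and> mem s' (T + v) = n + xs ! x j)"
        using that(2) uv by (auto simp: R_def)
      ultimately show ?thesis using lt[OF that(1) XY(1)[OF uv(1)]] by (auto simp: N_def)
    qed
    then have "measure_pmf.prob D {s'. close n (mem s' (T + u)) (mem s' (T + v))}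
      \<le> measure_pmf.prob (pmf_of_set ?P) {xs. \<exists>z\<in>N. xs ! z \<le> xs ! u}"
      by (intro D(3)) auto
    also have "\<dots> \<le> real d / (real d + 1)"
      using uv nonadj degree[OF uv(2)] XY(1) L(13)
      by (intro prob_permutation_not_first) (auto simp: N_def)
    finally show ?thesis .
  qed
  moreover have "(\<forall>r<20. r \<noteq> 15 \<longrightarrow> r \<noteq> 17 \<longrightarrow> reg s' r = reg s r) \<and>
      reg s' 15 = T + n \<and> reg s' 17 = reg s 17 - 1 \<and>
      (\<forall>a. a < T \<or> T + n \<le> a \<longrightarrow> mem s' a = mem s a) \<and>
      (\<forall>j<m. close n (mem s' (T + x j)) (mem s' (T + y j))) \<and>
      elapsed s' \<le> elapsed s + 5 * n + 16 * m + 12" if s': "s' \<in> set_pmf D" for s'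
  proof -
    obtain xs where xs: "xs \<in> ?P" "R xs s'" using D(2)[OF s'] by blast
    show ?thesis using edges[OF xs] xs(2) unfolding R_def by blast
  qed
  ultimately show ?thesis using D(1) by (intro exI[of _ D] conjI ballI impI; simp)
qed

text \<open>Each iteration writes a fresh row and leaves the earlier ones alone, so being
  unseparated so far is a persistent event as \<open>yields_While_prob\<close> requires.\<close>

lemma yields_random_rows:
  fixes s :: state
  defines "T \<equiv> reg s 15" and "t \<equiv> reg s 17"
  assumes layout: "layout n m X Y x y s"
    and degree: "\<And>v. v \<in> Y \<Longrightarrow> card (x ` {j. j < m \<and> y j = v}) \<le> d"
  shows "\<exists>D. yields (WhileNZ 17 random_row_prog) s D \<and>
    (\<forall>s'\<in>set_pmf D. (\<forall>r<15. reg s' r = reg s r) \<and>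
      (\<forall>a. a < T \<or> T + t * n \<le> a \<longrightarrow> mem s' a = mem s a) \<and>
      (\<forall>i<t. \<forall>j<m. close n (mem s' (T + i * n + x j)) (mem s' (T + i * n + y j))) \<and>
      elapsed s' \<le> elapsed s + t * (5 * n + 16 * m + 13) + 1) \<and>
    (\<forall>u\<in>X. \<forall>v\<in>Y. (\<forall>j<m. x j = u \<longrightarrow> y j \<noteq> v) \<longrightarrow>
      measure_pmf.prob D {s'. \<forall>i<t. close n (mem s' (T + i * n + u)) (mem s' (T + i * n + v))}
        \<le> (real d / (real d + 1)) ^ t)"
proof -
  define I where "I i s' \<longleftrightarrow> layout n m X Y x y s' \<and> (\<forall>r<15. reg s' r = reg s r) \<and>
      reg s' 15 = T + i * n \<and> reg s' 17 = t - i \<and>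
      (\<forall>a. a < T \<or> T + i * n \<le> a \<longrightarrow> mem s' a = mem s a) \<and>
      (\<forall>k<i. \<forall>j<m. close n (mem s' (T + k * n + x j)) (mem s' (T + k * n + y j))) \<and>
      elapsed s' \<le> elapsed s + i * (5 * n + 16 * m + 13)" for i and s' :: state
  define Q where "Q s' \<longleftrightarrow> (\<forall>r<15. reg s' r = reg s r) \<and> reg s' 17 = 0 \<and>
      (\<forall>a. a < T \<or> T + t * n \<le> a \<longrightarrow> mem s' a = mem s a) \<and>
      (\<forall>i<t. \<forall>j<m. close n (mem s' (T + i * n + x j)) (mem s' (T + i * n + y j))) \<and>
      elapsed s' \<le> elapsed s + t * (5 * n + 16 * m + 13) + 1" for s' :: state
  \<comment> \<open>Register 17 counts down from \<open>t\<close>, so \<open>t - reg s' 17\<close>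
    is the number of rows written so far. Pairs that are not nonadjacent pairs of opposite sides are
    never bad, which makes the bound hold for all \<open>p\<close>.\<close>
  define bad where "bad p s' \<longleftrightarrow> (case p of (u, v) \<Rightarrow> u \<in> X \<and> v \<in> Y \<and>
      (\<forall>j<m. x j = u \<longrightarrow> y j \<noteq> v) \<and>
      (\<forall>i<t - reg s' 17. close n (mem s' (T + i * n + u)) (mem s' (T + i * n + v))))" for p and s' :: state
  have XYn: "v < n" if "v \<in> X \<or> v \<in> Y" for v
    using layout that by (auto simp: layout_def)
  have xy: "x j \<in> X" "y j \<in> Y" if "j < m" for j
    using layout that by (auto simp: layout_def)
  have cell: "T + k * n + v < T + i * n" if "k < i" "v < n" for k i v
  proof -
    have "(k + 1) * n \<le> i * n" using that by (intro mult_right_mono) auto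
    then show ?thesis using that by simp
  qed
  have "\<exists>D. yields (WhileNZ 17 random_row_prog) s D \<and>
      (\<forall>s'\<in>set_pmf D. Q s' \<and> (\<forall>p. bad p s' \<longrightarrow> bad p s)) \<and>
      (\<forall>p. measure_pmf.prob D {s'. bad p s'} \<le> (real d / (real d + 1)) ^ (t - 0))"
  proof (rule yields_While_prob[where I = I])
    show "I 0 s" using layout by (simp add: I_def T_def t_def)
    show "reg s' 17 = 0 \<and> Q (charge 1 s') \<and> (\<forall>p. bad p (charge 1 s') \<longrightarrow> bad p s')" if "I t s'" for s'
      using that by (simp add: I_def Q_def bad_def)
  next
    fix i s1 assume i: "i < t" and I1: "I i s1"
    let ?s = "charge 1 s1"
    have I: "layout n m X Y x y ?s" "\<And>r. r < 15 \<Longrightarrow> reg s1 r = reg s r" "reg s1 15 = T + i * n"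
      "reg s1 17 = t - i" "\<And>a. a < T \<or> T + i * n \<le> a \<Longrightarrow> mem s1 a = mem s a"
      "\<And>k j. k < i \<Longrightarrow> j < m \<Longrightarrow> close n (mem s1 (T + k * n + x j)) (mem s1 (T + k * n + y j))"
      "elapsed s1 \<le> elapsed s + i * (5 * n + 16 * m + 13)"
      using I1 by (simp_all add: I_def) (erule disjE; simp)
    from yields_random_row_prog[OF I(1) degree, unfolded state_simps I(3,4)]
    obtain D where D': "yields random_row_prog ?s D \<and>
      (\<forall>s'\<in>set_pmf D. (\<forall>r<20. r \<noteq> 15 \<longrightarrow> r \<noteq> 17 \<longrightarrow> reg s' r = reg s1 r) \<and>
        reg s' 15 = T + i * n + n \<and> reg s' 17 = t - i - 1 \<and>
        (\<forall>a. a < T + i * n \<or> T + i * n + n \<le> a \<longrightarrow> mem s' a = mem s1 a) \<and>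
        (\<forall>j<m. close n (mem s' (T + i * n + x j)) (mem s' (T + i * n + y j))) \<and>
        elapsed s' \<le> elapsed s1 + 1 + 5 * n + 16 * m + 12) \<and>
      (\<forall>u\<in>X. \<forall>v\<in>Y. (\<forall>j<m. x j = u \<longrightarrow> y j \<noteq> v) \<longrightarrow>
        measure_pmf.prob D {s'. close n (mem s' (T + i * n + u)) (mem s' (T + i * n + v))}
          \<le> real d / (real d + 1))" ..
    then have D: "yields random_row_prog ?s D"
      "\<And>s' r. s' \<in> set_pmf D \<Longrightarrow> r < 20 \<Longrightarrow> r \<noteq> 15 \<Longrightarrow> r \<noteq> 17 \<Longrightarrow> reg s' r = reg s1 r"
      "\<And>s'. s' \<in> set_pmf D \<Longrightarrow> reg s' 15 = T + i * n + n"
      "\<And>s'. s' \<in> set_pmf D \<Longrightarrow> reg s' 17 = t - i - 1"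
      "\<And>s' a. s' \<in> set_pmf D \<Longrightarrow> a < T + i * n \<or> T + i * n + n \<le> a \<Longrightarrow> mem s' a = mem s1 a"
      "\<And>s' j. s' \<in> set_pmf D \<Longrightarrow> j < m \<Longrightarrow>
         close n (mem s' (T + i * n + x j)) (mem s' (T + i * n + y j))"
      "\<And>s'. s' \<in> set_pmf D \<Longrightarrow> elapsed s' \<le> elapsed s1 + 1 + 5 * n + 16 * m + 12"
      "\<And>u v. u \<in> X \<Longrightarrow> v \<in> Y \<Longrightarrow> \<forall>j<m. x j = u \<longrightarrow> y j \<noteq> v \<Longrightarrow>
         measure_pmf.prob D {s'. close n (mem s' (T + i * n + u)) (mem s' (T + i * n + v))}
           \<le> real d / (real d + 1)"
      by blast+
    have old: "mem s' (T + k * n + v) = mem s1 (T + k * n + v)"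
      if "s' \<in> set_pmf D" "k < i" "v < n" for s' k v
      using D(5)[OF that(1)] cell[OF that(2,3)] by blast
    have step: "I (Suc i) s'" if s': "s' \<in> set_pmf D" for s'
    proof -
      have "layout n m X Y x y s'"
        using D(2-5)[OF s'] I(1,3) by (intro layout_cong[OF I(1)]) auto
      moreover have "close n (mem s' (T + k * n + x j)) (mem s' (T + k * n + y j))"
        if "k < Suc i" "j < m" for k j
      proof (cases "k = i")
        case True
        then show ?thesis using D(6)[OF s' that(2)] by simp
      next
        case False
        then have k: "k < i" using that by simp
        show ?thesis
          using I(6)[OF k that(2)] old[OF s' k, of "x j"] old[OF s' k, of "y j"]
            XYn xy[OF that(2)] by simp
      qed
      moreover have "mem s' a = mem s a" if "a < T \<or> T + Suc i * n \<le> a" for a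
        using D(5)[OF s', of a] I(5)[of a] that by auto
      ultimately show ?thesis unfolding I_def
        using D(2-4,7)[OF s'] I(2,7) by (auto simp: algebra_simps)
    qed
    have bad: "bad p s1" if s': "s' \<in> set_pmf D" and "bad p s'" for s' p
      using that(2) D(4)[OF s'] I(4) i old[OF s', symmetric] XYn unfolding bad_def by auto
    have "measure_pmf.prob D {s'. bad p s'} \<le> real d / (real d + 1)" for p
    proof (cases "\<exists>u\<in>X. \<exists>v\<in>Y. p = (u, v) \<and> (\<forall>j<m. x j = u \<longrightarrow> y j \<noteq> v)")
      case True
      then obtain u v where p: "p = (u, v)" "u \<in> X" "v \<in> Y" "\<forall>j<m. x j = u \<longrightarrow> y j \<noteq> v" by blast
      have "measure_pmf.prob D {s'. bad p s'}
          \<le> measure_pmf.prob D {s'. close n (mem s' (T + i * n + u)) (mem s' (T + i * n + v))}"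
        using D(4) i p(1) unfolding bad_def
        by (intro measure_pmf.finite_measure_mono_AE) (auto simp: AE_measure_pmf_iff)
      also have "\<dots> \<le> real d / (real d + 1)" using D(8) p by blast
      finally show ?thesis .
    next
      case False
      then have "{s'. bad p s'} = {}" by (auto simp: bad_def split: prod.splits)
      then show ?thesis by simp
    qed
    then show "reg s1 17 \<noteq> 0 \<and> (\<exists>D. yields random_row_prog (charge 1 s1) D \<and>
        (\<forall>s'\<in>set_pmf D. I (Suc i) s' \<and> (\<forall>p. bad p s' \<longrightarrow> bad p s1)) \<and>
        (\<forall>p. measure_pmf.prob D {s'. bad p s'} \<le> real d / (real d + 1)))"
      using D(1) I(4) i step bad by (intro conjI exI[of _ D]) auto
  qed auto
  then obtain D where D: "yields (WhileNZ 17 random_row_prog) s D" "\<And>s'. s' \<in> set_pmf D \<Longrightarrow> Q s'"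
    "\<And>p. measure_pmf.prob D {s'. bad p s'} \<le> (real d / (real d + 1)) ^ t"
    by auto
  have "measure_pmf.prob D {s'. \<forall>i<t. close n (mem s' (T + i * n + u)) (mem s' (T + i * n + v))}
      \<le> (real d / (real d + 1)) ^ t" if "u \<in> X" "v \<in> Y" "\<forall>j<m. x j = u \<longrightarrow> y j \<noteq> v" for u v
  proof -
    have "measure_pmf.prob D {s'. \<forall>i<t. close n (mem s' (T + i * n + u)) (mem s' (T + i * n + v))}
      \<le> measure_pmf.prob D {s'. bad (u, v) s'}"
      using that by (intro measure_pmf.finite_measure_mono_AE) (auto simp: AE_measure_pmf_iff bad_def)
    then show ?thesis using D(3) order_trans by blast
  qed
  then show ?thesis using D(1,2) unfolding Q_def by blast
qed

text \<open>A bound valid from every state satisfying \<open>Q\<close> survives a prefix that surely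
  establishes \<open>Q\<close>: averaging over intermediate states cannot raise it.\<close>

lemma yields_Seq_prob:
  assumes p: "wp p s Q"
    and q: "\<And>s1. Q s1 \<Longrightarrow> \<exists>D. yields q s1 D \<and> (\<forall>s'\<in>set_pmf D. R s') \<and>
      (\<forall>i\<in>J. measure_pmf.prob D (S i) \<le> b)"
    and "0 \<le> b"
  shows "\<exists>D. yields (p ;; q) s D \<and> (\<forall>s'\<in>set_pmf D. R s') \<and>
    (\<forall>i\<in>J. measure_pmf.prob D (S i) \<le> b)"
proof -
  obtain D where D: "yields p s D" "\<And>s1. s1 \<in> set_pmf D \<Longrightarrow> Q s1"
    using p unfolding wp_def by blast
  have "\<forall>s1\<in>set_pmf D. \<exists>D'. yields q s1 D' \<and> (\<forall>s'\<in>set_pmf D'. R s') \<and>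
      (\<forall>i\<in>J. measure_pmf.prob D' (S i) \<le> b)"
    using q D(2) by blast
  from bchoice[OF this] obtain F where F: "\<forall>s1\<in>set_pmf D. yields q s1 (F s1) \<and>
      (\<forall>s'\<in>set_pmf (F s1). R s') \<and> (\<forall>i\<in>J. measure_pmf.prob (F s1) (S i) \<le> b)" ..
  show ?thesis
  proof (intro exI conjI ballI)
    show "yields (p ;; q) s (bind_pmf D F)" using F D(1) by (intro yields_Seq) blast+
    show "R s'" if "s' \<in> set_pmf (bind_pmf D F)" for s'
      using that F unfolding set_bind_pmf by blast
    have "measure_pmf.prob (bind_pmf D F) (S i) \<le> 1 * b" if "i \<in> J" for i
      using F that \<open>0 \<le> b\<close> by (intro prob_bind_pmf_le[where T = UNIV]) auto
    then show "measure_pmf.prob (bind_pmf D F) (S i) \<le> b" if "i \<in> J" for i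
      using that by simp
  qed
qed

lemma close_sym: "close n a b \<longleftrightarrow> close n b a"
  by (auto simp: close_def)

lemma bits_differ:
  fixes u v :: nat
  assumes "u < 2 ^ K" "v < 2 ^ K" "u \<noteq> v"
  shows "\<exists>j<K. odd (u div 2 ^ j) \<noteq> odd (v div 2 ^ j)"
proof (rule ccontr)
  assume "\<not> ?thesis"
  then have "bit u j = bit v j" if "j < K" for j
    using that unfolding bit_iff_odd by blast
  then have "take_bit K u = take_bit K v"
    by (intro bit_eqI) (auto simp: bit_take_bit_iff)
  then show False using assms by (simp add: take_bit_nat_eq_self)
qed

text \<open>Adjacent pairs are close in every row \<open>i\<close>, without an upper limit. This
  lets the output dimension exceed the number 2 K + t of rows that are written.\<close>

lemma yields_rows:
  fixes s :: state
  defines "T \<equiv> reg s 15" and "t \<equiv> reg s 17"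
  assumes layout: "layout n m X Y x y s"
    and degree: "\<And>v. v \<in> Y \<Longrightarrow> card (x ` {j. j < m \<and> y j = v}) \<le> d"
    and zero: "\<And>a. T \<le> a \<Longrightarrow> mem s a = 0"
    and K: "n \<le> 2 ^ K" "\<And>j. j < K \<Longrightarrow> 2 ^ j < n"
  shows "\<exists>D. yields (bit_rows_prog ;; WhileNZ 17 random_row_prog) s D \<and>
    (\<forall>s'\<in>set_pmf D. (\<forall>r<15. reg s' r = reg s r) \<and>
      (\<forall>i. \<forall>j<m. close n (mem s' (T + i * n + x j)) (mem s' (T + i * n + y j))) \<and>
      (\<forall>u v. u \<noteq> v \<longrightarrow> u \<in> X \<and> v \<in> X \<or> u \<in> Y \<and> v \<in> Y \<longrightarrow>
        (\<exists>i<2 * K. \<not> close n (mem s' (T + i * n + u)) (mem s' (T + i * n + v)))) \<and>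
      elapsed s' \<le> elapsed s + K * (24 * n + 21) + t * (5 * n + 16 * m + 13) + 4) \<and>
    (\<forall>(u, v)\<in>{(u, v). u \<in> X \<and> v \<in> Y \<and> (\<forall>j<m. x j = u \<longrightarrow> y j \<noteq> v)}.
      measure_pmf.prob D {s'. \<forall>i<2 * K + t.
          close n (mem s' (T + i * n + u)) (mem s' (T + i * n + v))}
        \<le> (real d / (real d + 1)) ^ t)"
proof -
  have L: "reg s 1 = n" "reg s 5 = 1" "reg s 14 = 2 * reg s 1" "reg s 19 = 0"
    "X = {reg s 8..<reg s 8 + reg s 9}" "Y = {reg s 10..<reg s 10 + reg s 11}"
    "X \<inter> Y = {}" "X \<union> Y = {..<n}" "\<And>j. j < m \<Longrightarrow> x j \<in> X" "\<And>j. j < m \<Longrightarrow> y j \<in> Y"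
    using layout by (auto simp: layout_def)
  have XY: "v < n" if "v \<in> X \<or> v \<in> Y" for v using that L(8) by blast
  let ?T = "T + 2 * K * n"
  define Q where "Q s1 \<longleftrightarrow> layout n m X Y x y s1 \<and> (\<forall>r<15. reg s1 r = reg s r) \<and>
    reg s1 15 = ?T \<and> reg s1 17 = t \<and>
    (\<forall>j v. j < K \<longrightarrow> v < n \<longrightarrow> mem s1 (T + 2 * j * n + v) = bit_row n X (2 ^ j) v) \<and>
    (\<forall>j v. j < K \<longrightarrow> v < n \<longrightarrow> mem s1 (T + (2 * j + 1) * n + v) = bit_row n Y (2 ^ j) v) \<and>
    (\<forall>a. ?T \<le> a \<longrightarrow> mem s1 a = 0) \<and>
    elapsed s1 \<le> elapsed s + 3 + K * (24 * n + 21)" for s1 :: state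
  have wpQ: "wp bit_rows_prog s Q"
  proof (rule wp_bit_rows_prog[where X = X and Y = Y and K = K], goal_cases)
    case (10 s')
    note Q = 10[unfolded L(1) T_def[symmetric]]
    have "layout n m X Y x y s'"
      using Q(1,2,5) by (intro layout_cong[OF layout]) (auto simp: T_def)
    moreover have "mem s' a = 0" if "?T \<le> a" for a
      using Q(5)[of a] zero[of a] that by simp
    ultimately show ?case unfolding Q_def using Q(1-4,6) by (simp add: t_def)
  qed (use L K XY in auto)
  define R where "R s' \<longleftrightarrow> (\<forall>r<15. reg s' r = reg s r) \<and>
      (\<forall>i. \<forall>j<m. close n (mem s' (T + i * n + x j)) (mem s' (T + i * n + y j))) \<and>
      (\<forall>u v. u \<noteq> v \<longrightarrow> u \<in> X \<and> v \<in> X \<or> u \<in> Y \<and> v \<in> Y \<longrightarrow>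
        (\<exists>i<2 * K. \<not> close n (mem s' (T + i * n + u)) (mem s' (T + i * n + v)))) \<and>
      elapsed s' \<le> elapsed s + K * (24 * n + 21) + t * (5 * n + 16 * m + 13) + 4" for s' :: state
  define J where "J = {(u, v). u \<in> X \<and> v \<in> Y \<and> (\<forall>j<m. x j = u \<longrightarrow> y j \<noteq> v)}"
  define S where "S p = {s' :: state. \<forall>i<2 * K + t.
    close n (mem s' (T + i * n + fst p)) (mem s' (T + i * n + snd p))}"
    for p :: "nat \<times> nat"
  have cell: "T + i * n + v < ?T" if "i < 2 * K" "v < n" for i v
  proof -
    have "(i + 1) * n \<le> 2 * K * n" using that by (intro mult_right_mono) auto
    then show ?thesis using that by simp
  qed
  have "\<exists>D. yields (bit_rows_prog ;; WhileNZ 17 random_row_prog) s D \<and> (\<forall>s'\<in>set_pmf D. R s') \<and>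
    (\<forall>p\<in>J. measure_pmf.prob D (S p) \<le> (real d / (real d + 1)) ^ t)"
  proof (rule yields_Seq_prob[OF wpQ])
    fix s1 assume "Q s1"
    then have Q: "layout n m X Y x y s1" "\<And>r. r < 15 \<Longrightarrow> reg s1 r = reg s r"
      "reg s1 15 = ?T" "reg s1 17 = t"
      "\<And>j v. j < K \<Longrightarrow> v < n \<Longrightarrow> mem s1 (T + 2 * j * n + v) = bit_row n X (2 ^ j) v"
      "\<And>j v. j < K \<Longrightarrow> v < n \<Longrightarrow> mem s1 (T + (2 * j + 1) * n + v) = bit_row n Y (2 ^ j) v"
      "\<And>a. ?T \<le> a \<Longrightarrow> mem s1 a = 0" "elapsed s1 \<le> elapsed s + 3 + K * (24 * n + 21)"
      unfolding Q_def by blast+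
    from yields_random_rows[OF Q(1) degree, unfolded Q(3,4)]
    obtain D where D': "yields (WhileNZ 17 random_row_prog) s1 D \<and>
    (\<forall>s'\<in>set_pmf D. (\<forall>r<15. reg s' r = reg s1 r) \<and>
      (\<forall>a. a < ?T \<or> ?T + t * n \<le> a \<longrightarrow> mem s' a = mem s1 a) \<and>
      (\<forall>i<t. \<forall>j<m. close n (mem s' (?T + i * n + x j)) (mem s' (?T + i * n + y j))) \<and>
      elapsed s' \<le> elapsed s1 + t * (5 * n + 16 * m + 13) + 1) \<and>
    (\<forall>u\<in>X. \<forall>v\<in>Y. (\<forall>j<m. x j = u \<longrightarrow> y j \<noteq> v) \<longrightarrow>
      measure_pmf.prob D {s'. \<forall>i<t. close n (mem s' (?T + i * n + u)) (mem s' (?T + i * n + v))}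
        \<le> (real d / (real d + 1)) ^ t)" ..
    then have D: "yields (WhileNZ 17 random_row_prog) s1 D"
      "\<And>s' r. s' \<in> set_pmf D \<Longrightarrow> r < 15 \<Longrightarrow> reg s' r = reg s1 r"
      "\<And>s' a. s' \<in> set_pmf D \<Longrightarrow> a < ?T \<or> ?T + t * n \<le> a \<Longrightarrow> mem s' a = mem s1 a"
      "\<And>s' i j. s' \<in> set_pmf D \<Longrightarrow> i < t \<Longrightarrow> j < m \<Longrightarrow>
        close n (mem s' (?T + i * n + x j)) (mem s' (?T + i * n + y j))"
      "\<And>s'. s' \<in> set_pmf D \<Longrightarrow> elapsed s' \<le> elapsed s1 + t * (5 * n + 16 * m + 13) + 1"
      "\<And>u v. u \<in> X \<Longrightarrow> v \<in> Y \<Longrightarrow> \<forall>j<m. x j = u \<longrightarrow> y j \<noteq> v \<Longrightarrow>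
        measure_pmf.prob D {s'. \<forall>i<t. close n (mem s' (?T + i * n + u)) (mem s' (?T + i * n + v))}
        \<le> (real d / (real d + 1)) ^ t"
      by blast+
    have row: "mem s' (T + 2 * j * n + v) = bit_row n X (2 ^ j) v"
      "mem s' (T + (2 * j + 1) * n + v) = bit_row n Y (2 ^ j) v"
      if "s' \<in> set_pmf D" "j < K" "v < n" for s' j v
      using D(3)[OF that(1)] cell[of "2 * j" v] cell[of "2 * j + 1" v] Q(5,6)[OF that(2,3)] that
      by simp_all
    have edges: "close n (mem s' (T + i * n + x j)) (mem s' (T + i * n + y j))"
      if s': "s' \<in> set_pmf D" and j: "j < m" for s' i j
    proof -
      have xj: "x j \<in> X" "x j \<notin> Y" "y j \<in> Y" "y j \<notin> X" "x j < n" "y j < n"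
        using L(7,9,10) j XY by blast+
      \<comment> \<open>A row holds \<open>X\<close> at \<open>n\<close>, holds \<open>Y\<close> at
        \<open>n\<close>, is random, or is still zero.\<close>
      consider k where "i = 2 * k" "k < K" | k where "i = 2 * k + 1" "k < K"
        | k where "i = 2 * K + k" "k < t" | "2 * K + t \<le> i"
      proof (cases "i < 2 * K + t")
        case True
        then show ?thesis
        proof (cases "i < 2 * K")
          case True
          then show ?thesis using that(1)[of "i div 2"] that(2)[of "i div 2"]
            by (cases "even i") (auto simp: dvd_mult_div_cancel)
        next
          case False
          then show ?thesis using that(3)[of "i - 2 * K"] True by simp
        qed
      qed (use that(4) in simp)
      then show ?thesis
      proof cases
        case 1
        show ?thesis unfolding 1(1) row(1)[OF s' 1(2) xj(5)] row(1)[OF s' 1(2) xj(6)]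
          using xj by (simp add: bit_row_def close_def)
      next
        case 2
        show ?thesis unfolding 2(1) row(2)[OF s' 2(2) xj(5)] row(2)[OF s' 2(2) xj(6)]
          using xj by (simp add: bit_row_def close_def)
      next
        case 3
        then show ?thesis using D(4)[OF s' 3(2) j] by (simp add: algebra_simps)
      next
        case 4
        have "(2 * K + t) * n \<le> i * n" using 4 by (intro mult_right_mono) auto
        then have le: "?T + t * n \<le> T + i * n" by (simp add: algebra_simps)
        have "mem s' (T + i * n + v) = 0" for v
          using D(3)[OF s', of "T + i * n + v"] Q(7)[of "T + i * n + v"] le by simp
        then show ?thesis by (simp add: close_def)
      qed
    qed
    have same: "\<exists>i<2 * K. \<not> close n (mem s' (T + i * n + u)) (mem s' (T + i * n + v))"
      if s': "s' \<in> set_pmf D" and uv: "u \<noteq> v" "u \<in> X \<and> v \<in> X \<or> u \<in> Y \<and> v \<in> Y" for s' u v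
    proof -
      have lt: "u < n" "v < n" using uv XY by blast+
      obtain j where j: "j < K" "odd (u div 2 ^ j) \<noteq> odd (v div 2 ^ j)"
        using bits_differ[of u K v] uv(1) lt K(1) by auto
      show ?thesis
      proof (cases "u \<in> X")
        case True
        then have "u \<notin> Y" "v \<notin> Y" using uv L(7) by blast+
        then have "\<not> close n (mem s' (T + (2 * j + 1) * n + u)) (mem s' (T + (2 * j + 1) * n + v))"
          unfolding row(2)[OF s' j(1) lt(1)] row(2)[OF s' j(1) lt(2)]
          using j(2) lt by (auto simp: bit_row_def close_def)
        then show ?thesis using j(1) by (intro exI[of _ "2 * j + 1"]) auto
      next
        case False
        then have "u \<notin> X" "v \<notin> X" using uv L(7) by blast+
        then have "\<not> close n (mem s' (T + 2 * j * n + u)) (mem s' (T + 2 * j * n + v))"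
          unfolding row(1)[OF s' j(1) lt(1)] row(1)[OF s' j(1) lt(2)]
          using j(2) lt by (auto simp: bit_row_def close_def)
        then show ?thesis using j(1) by (intro exI[of _ "2 * j"]) auto
      qed
    qed
    have "R s'" if s': "s' \<in> set_pmf D" for s'
      unfolding R_def using edges[OF s'] same[OF s'] D(2,5)[OF s'] Q(2,8)
      by (intro conjI allI impI) (simp_all, fastforce?)
    moreover have "measure_pmf.prob D (S p) \<le> (real d / (real d + 1)) ^ t" if "p \<in> J" for p
    proof -
      have "measure_pmf.prob D (S p) \<le> measure_pmf.prob D
        {s'. \<forall>i<t. close n (mem s' (?T + i * n + fst p)) (mem s' (?T + i * n + snd p))}"
      proof (intro measure_pmf.finite_measure_mono subsetI CollectI allI impI)
        fix s' i assume "s' \<in> S p" "i < t"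
        \<comment> \<open>Random row \<open>i\<close> is row 2 K + i of the table.\<close>
        then have "close n (mem s' (T + (2 * K + i) * n + fst p)) (mem s' (T + (2 * K + i) * n + snd p))"
          unfolding S_def by auto
        then show "close n (mem s' (?T + i * n + fst p)) (mem s' (?T + i * n + snd p))"
          by (simp add: algebra_simps)
      qed simp
      also have "\<dots> \<le> (real d / (real d + 1)) ^ t"
        using that D(6)[of "fst p" "snd p"] by (auto simp: J_def)
      finally show ?thesis .
    qed
    ultimately show "\<exists>D. yields (WhileNZ 17 random_row_prog) s1 D \<and> (\<forall>s'\<in>set_pmf D. R s') \<and>
      (\<forall>p\<in>J. measure_pmf.prob D (S p) \<le> (real d / (real d + 1)) ^ t)"
      using D(1) by blast
  qed simp
  then show ?thesis unfolding R_def S_def J_def by (simp add: case_prod_beta)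
qed

section \<open>The algorithm\<close>

definition main_prog :: prog where
  "main_prog = setup_prog ;; bit_rows_prog ;; WhileNZ 17 random_row_prog"

text \<open>The roles of \<open>X\<close> and \<open>Y\<close> disappear from the statement: both
  outcomes of the comparison of degrees lead to the same claim in terms of the numbering of the two
  given sides. The constant 42 is the 38 of the setup and 4 for the rows.\<close>

lemma yields_main_prog:
  fixes as bs :: "'v list" and es :: "(nat \<times> nat) list" and K :: nat
  defines "dA \<equiv> max_occurrences (\<lambda>j. fst (es ! j)) (length es)"
    and "dB \<equiv> max_occurrences (\<lambda>j. snd (es ! j)) (length es)"
    and "T \<equiv> 3 + 2 * length es + length as + length bs"
    and "n \<equiv> length as + length bs"
  defines "d \<equiv> min dA dB"
  defines "t \<equiv> 3 * Suc d * (rounds (length bs) - 5)"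
  assumes es: "set es \<subseteq> {..<length as} \<times> {..<length bs}" and "0 < length bs"
    and K: "n \<le> 2 ^ K" "\<And>j. j < K \<Longrightarrow> 2 ^ j < n"
  shows "\<exists>D. yields main_prog (initial_state (graph_input as bs es)) D \<and>
    (\<forall>s\<in>set_pmf D. reg s 0 = T \<and> reg s 1 = n \<and>
      (\<forall>i. \<forall>(a, b)\<in>set es.
        close n (mem s (T + i * n + a)) (mem s (T + i * n + (length as + b)))) \<and>
      (\<forall>u v. u \<noteq> v \<longrightarrow> u < length as \<and> v < length as \<or>
          length as \<le> u \<and> u < n \<and> length as \<le> v \<and> v < n \<longrightarrow>
        (\<exists>i<2 * K. \<not> close n (mem s (T + i * n + u)) (mem s (T + i * n + v)))) \<and>
      elapsed s \<le> 42 + 18 * length es + 4 * length bs +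
        3 * (\<Sum>i=1..length bs. ceil_div (length bs) i) + 3 * rounds (length bs) +
        K * (24 * n + 21) + t * (5 * n + 16 * length es + 13)) \<and>
    (\<forall>p\<in>{(a, b). a < length as \<and> b < length bs \<and> (a, b) \<notin> set es}.
      measure_pmf.prob D {s. \<forall>i<2 * K + t. close n (mem s (T + i * n + fst p))
          (mem s (T + i * n + (length as + snd p)))}
        \<le> (real d / (real d + 1)) ^ t)"
proof -
  let ?n1 = "length as" and ?n2 = "length bs" and ?m = "length es"
  define e0 where "e0 = 38 + 18 * ?m + 4 * ?n2 + 3 * (\<Sum>i=1..?n2. ceil_div ?n2 i) + 3 * rounds ?n2"
  define J where "J = {(a, b). a < ?n1 \<and> b < ?n2 \<and> (a, b) \<notin> set es}"
  define S where "S p = {s :: state. \<forall>i<2 * K + t. close n (mem s (T + i * n + fst p))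
          (mem s (T + i * n + (?n1 + snd p)))}"
    for p
  define R where "R s \<longleftrightarrow> reg s 0 = T \<and> reg s 1 = n \<and>
      (\<forall>i. \<forall>(a, b)\<in>set es.
        close n (mem s (T + i * n + a)) (mem s (T + i * n + (?n1 + b)))) \<and>
      (\<forall>u v. u \<noteq> v \<longrightarrow> u < ?n1 \<and> v < ?n1 \<or> ?n1 \<le> u \<and> u < n \<and> ?n1 \<le> v \<and> v < n \<longrightarrow>
        (\<exists>i<2 * K. \<not> close n (mem s (T + i * n + u)) (mem s (T + i * n + v)))) \<and>
      elapsed s \<le> e0 + K * (24 * n + 21) + t * (5 * n + 16 * ?m + 13) + 4" for s :: state
  define Q where "Q s \<longleftrightarrow> reg s 0 = T \<and> reg s 1 = n \<and> reg s 4 = ?m \<and> reg s 5 = 1 \<and>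
    reg s 14 = 2 * n \<and> reg s 15 = T \<and> reg s 19 = 0 \<and>
    (reg s 8, reg s 9, reg s 10, reg s 11, reg s 12, reg s 13) =
        (if dB < dA then (0, ?n1, ?n1, ?n2, 3, 4) else (?n1, ?n2, 0, ?n1, 4, 3)) \<and>
    reg s 17 = t \<and> (\<forall>j<?m. mem s (3 + 2 * j) = fst (es ! j)) \<and>
    (\<forall>j<?m. mem s (4 + 2 * j) = snd (es ! j)) \<and> (\<forall>a\<ge>T. mem s a = 0) \<and> elapsed s = e0"
    for s :: state
  have range: "fst (es ! j) < ?n1" "snd (es ! j) < ?n2" if "j < ?m" for j
    using es nth_mem[OF that] by auto
  have wpQ: "wp setup_prog (initial_state (graph_input as bs es)) Q"
  proof (rule wp_setup_prog[OF es \<open>0 < ?n2\<close>], goal_cases)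
    case (1 s)
    then show ?case
      unfolding Q_def n_def T_def t_def d_def e0_def dA_def dB_def by blast
  qed
  \<comment> \<open>The number of distinct neighbours is at most the number of listed edges at the
    vertex.\<close>
  have occ: "card (f ` {j. j < ?m \<and> g j = v}) \<le> max_occurrences g ?m"
    for f :: "nat \<Rightarrow> nat" and g :: "nat \<Rightarrow> nat" and v
    using card_image_le[of "{j. j < ?m \<and> g j = v}" f] occurrences_le_max[of g ?m v]
    by (simp add: occurrences_eq_card)
  have nonadj: "\<forall>j<?m. fst (es ! j) = fst p \<longrightarrow> snd (es ! j) \<noteq> snd p"
    "\<forall>j<?m. snd (es ! j) = snd p \<longrightarrow> fst (es ! j) \<noteq> fst p" if "p \<in> J" for p
    using that nth_mem[of _ es] by (metis (mono_tags, lifting) J_def mem_Collect_eq case_prod_conv prod.collapse)+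
  have "\<exists>D. yields (setup_prog ;; bit_rows_prog ;; WhileNZ 17 random_row_prog)
        (initial_state (graph_input as bs es)) D \<and>
    (\<forall>s\<in>set_pmf D. R s) \<and> (\<forall>p\<in>J. measure_pmf.prob D (S p) \<le> (real d / (real d + 1)) ^ t)"
  proof (rule yields_Seq_prob[OF wpQ])
    fix s assume "Q s"
    then have s: "reg s 0 = T" "reg s 1 = n" "reg s 4 = ?m" "reg s 5 = 1" "reg s 14 = 2 * n"
      "reg s 15 = T" "reg s 19 = 0" "reg s 17 = t"
      "\<And>j. j < ?m \<Longrightarrow> mem s (3 + 2 * j) = fst (es ! j)"
      "\<And>j. j < ?m \<Longrightarrow> mem s (4 + 2 * j) = snd (es ! j)" "\<And>a. T \<le> a \<Longrightarrow> mem s a = 0"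
      "elapsed s = e0"
      unfolding Q_def by blast+
    have R: "R s'" if regs: "\<And>r. r < 15 \<Longrightarrow> reg s' r = reg s r"
      and edge: "\<And>i j. j < ?m \<Longrightarrow> close n (mem s' (T + i * n + fst (es ! j)))
         (mem s' (T + i * n + (?n1 + snd (es ! j))))"
      and same: "\<And>u v. u \<noteq> v \<Longrightarrow> u < ?n1 \<and> v < ?n1 \<or> ?n1 \<le> u \<and> u < n \<and> ?n1 \<le> v \<and> v < n \<Longrightarrow>
        \<exists>i<2 * K. \<not> close n (mem s' (T + i * n + u)) (mem s' (T + i * n + v))"
      and time: "elapsed s' \<le> elapsed s + K * (24 * n + 21) + t * (5 * n + 16 * ?m + 13) + 4" for s'
    proof -
      have "close n (mem s' (T + i * n + a)) (mem s' (T + i * n + (?n1 + b)))"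
        if "(a, b) \<in> set es" for i a b
        using that edge by (metis fst_conv in_set_conv_nth snd_conv)
      then show ?thesis unfolding R_def using regs same time s by auto
    qed
    show "\<exists>D. yields (bit_rows_prog ;; WhileNZ 17 random_row_prog) s D \<and> (\<forall>s\<in>set_pmf D. R s) \<and>
      (\<forall>p\<in>J. measure_pmf.prob D (S p) \<le> (real d / (real d + 1)) ^ t)"
    proof (cases "dB < dA")
      case True
      define x where "x j = fst (es ! j)" for j
      define y where "y j = ?n1 + snd (es ! j)" for j
      have sides: "reg s 8 = 0" "reg s 9 = ?n1" "reg s 10 = ?n1" "reg s 11 = ?n2"
        "reg s 12 = 3" "reg s 13 = 4"
        using \<open>Q s\<close> True by (simp_all add: Q_def)
      have layout: "layout n ?m {..<?n1} {?n1..<n} x y s"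
        unfolding layout_def sides s(1-7)
        using s(9,10) range by (auto simp: n_def x_def y_def T_def lessThan_atLeast0)
      have "{j. j < ?m \<and> y j = v} = {j. j < ?m \<and> snd (es ! j) = v - ?n1}" if "?n1 \<le> v" for v
        using that by (auto simp: y_def)
      then have deg: "card (x ` {j. j < ?m \<and> y j = v}) \<le> d" if "v \<in> {?n1..<n}" for v
        using occ[of x "\<lambda>j. snd (es ! j)" "v - ?n1"] that True by (simp add: d_def dB_def)
      from yields_rows[OF layout deg, unfolded s(6,8), OF _ s(11) K] obtain D where
        D': "yields (bit_rows_prog ;; WhileNZ 17 random_row_prog) s D \<and>
        (\<forall>s'\<in>set_pmf D. (\<forall>r<15. reg s' r = reg s r) \<and>
         (\<forall>i. \<forall>j<?m. close n (mem s' (T + i * n + x j)) (mem s' (T + i * n + y j))) \<and>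
         (\<forall>u v. u \<noteq> v \<longrightarrow> u \<in> {..<?n1} \<and> v \<in> {..<?n1} \<or> u \<in> {?n1..<n} \<and> v \<in> {?n1..<n} \<longrightarrow>
           (\<exists>i<2 * K. \<not> close n (mem s' (T + i * n + u)) (mem s' (T + i * n + v)))) \<and>
         elapsed s' \<le> elapsed s + K * (24 * n + 21) + t * (5 * n + 16 * ?m + 13) + 4) \<and>
        (\<forall>(u, v)\<in>{(u, v). u \<in> {..<?n1} \<and> v \<in> {?n1..<n} \<and> (\<forall>j<?m. x j = u \<longrightarrow> y j \<noteq> v)}.
          measure_pmf.prob D {s'. \<forall>i<2 * K + t.
            close n (mem s' (T + i * n + u)) (mem s' (T + i * n + v))}
          \<le> (real d / (real d + 1)) ^ t)" ..
      note D = bspec[OF D'[THEN conjunct2, THEN conjunct1]]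
        and P = D'[THEN conjunct2, THEN conjunct2]
      from D' have "yields (bit_rows_prog ;; WhileNZ 17 random_row_prog) s D" ..
      moreover have "R s'" if "s' \<in> set_pmf D" for s'
        using D[OF that] by (intro R) (auto simp: x_def y_def)
      moreover have "measure_pmf.prob D (S p) \<le> (real d / (real d + 1)) ^ t" if "p \<in> J" for p
        using bspec[OF P, of "(fst p, ?n1 + snd p)"] nonadj[OF that] that
        by (auto simp: S_def J_def n_def x_def y_def)
      ultimately show ?thesis by blast
    next
      case False
      define x where "x j = ?n1 + snd (es ! j)" for j
      define y where "y j = fst (es ! j)" for j
      have sides: "reg s 8 = ?n1" "reg s 9 = ?n2" "reg s 10 = 0" "reg s 11 = ?n1"
        "reg s 12 = 4" "reg s 13 = 3"
        using \<open>Q s\<close> False by (simp_all add: Q_def)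
      have layout: "layout n ?m {?n1..<n} {..<?n1} x y s"
        unfolding layout_def sides s(1-7)
        using s(9,10) range by (auto simp: n_def x_def y_def T_def lessThan_atLeast0)
      have deg: "card (x ` {j. j < ?m \<and> y j = v}) \<le> d" for v
        using occ[of x y v] False by (simp add: d_def dA_def y_def[abs_def])
      from yields_rows[OF layout deg, unfolded s(6,8), OF s(11) K] obtain D where
        D': "yields (bit_rows_prog ;; WhileNZ 17 random_row_prog) s D \<and>
        (\<forall>s'\<in>set_pmf D. (\<forall>r<15. reg s' r = reg s r) \<and>
         (\<forall>i. \<forall>j<?m. close n (mem s' (T + i * n + x j)) (mem s' (T + i * n + y j))) \<and>
         (\<forall>u v. u \<noteq> v \<longrightarrow> u \<in> {?n1..<n} \<and> v \<in> {?n1..<n} \<or> u \<in> {..<?n1} \<and> v \<in> {..<?n1} \<longrightarrow>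
           (\<exists>i<2 * K. \<not> close n (mem s' (T + i * n + u)) (mem s' (T + i * n + v)))) \<and>
         elapsed s' \<le> elapsed s + K * (24 * n + 21) + t * (5 * n + 16 * ?m + 13) + 4) \<and>
        (\<forall>(u, v)\<in>{(u, v). u \<in> {?n1..<n} \<and> v \<in> {..<?n1} \<and> (\<forall>j<?m. x j = u \<longrightarrow> y j \<noteq> v)}.
          measure_pmf.prob D {s'. \<forall>i<2 * K + t.
            close n (mem s' (T + i * n + u)) (mem s' (T + i * n + v))}
          \<le> (real d / (real d + 1)) ^ t)" ..
      note D = bspec[OF D'[THEN conjunct2, THEN conjunct1]]
        and P = D'[THEN conjunct2, THEN conjunct2]
      from D' have "yields (bit_rows_prog ;; WhileNZ 17 random_row_prog) s D" ..
      moreover have "R s'" if "s' \<in> set_pmf D" for s'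
        using D[OF that] by (intro R) (auto simp: x_def y_def close_sym)
      \<comment> \<open>Here \<open>X\<close> is the second side, so the pair is passed in exchanged
        order and closeness is turned around by symmetry.\<close>
      moreover have "measure_pmf.prob D (S p) \<le> (real d / (real d + 1)) ^ t" if "p \<in> J" for p
        using bspec[OF P, of "(?n1 + snd p, fst p)"] nonadj[OF that] that
        by (auto simp: S_def J_def n_def x_def y_def close_sym)
      ultimately show ?thesis by blast
    qed
  qed simp
  then show ?thesis unfolding R_def S_def J_def main_prog_def e0_def by (simp add: ac_simps)
qed

lemma cubes_intersect_iff:
  "cube k a \<inter> cube k b \<noteq> {} \<longleftrightarrow> (\<forall>i<k. \<bar>a i - b i\<bar> \<le> 1)"
proof -
  have "{a i..a i + 1} \<inter> {b i..b i + 1} \<noteq> {} \<longleftrightarrow> \<bar>a i - b i\<bar> \<le> 1" for i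
    by (auto simp: Int_atLeastAtMost)
  then show ?thesis by (simp add: cube_def PiE_Int PiE_eq_empty_iff Ball_def)
qed

text \<open>Multiplying by the common denominator turns intersection of unit intervals into
  closeness of numerators.\<close>

lemma output_cubes_intersect_iff:
  assumes "reg s 1 > 0"
  shows "output_cube k n s u \<inter> output_cube k n s v \<noteq> {} \<longleftrightarrow>
    (\<forall>i<k. close (reg s 1) (mem s (reg s 0 + i * n + u)) (mem s (reg s 0 + i * n + v)))"
proof -
  have "\<bar>real a / real c - real b / real c\<bar> \<le> 1 \<longleftrightarrow> close c a b" if "c > 0" for a b c :: nat
  proof -
    have "\<bar>real a / real c - real b / real c\<bar> = \<bar>real a - real b\<bar> / real c"
      by (simp add: diff_divide_distrib[symmetric])
    also have "\<dots> \<le> 1 \<longleftrightarrow> \<bar>real a - real b\<bar> \<le> real c" using that by simp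
    also have "\<dots> \<longleftrightarrow> close c a b" unfolding close_def by linarith
    finally show ?thesis .
  qed
  then show ?thesis using assms unfolding output_cube_def cubes_intersect_iff by simp
qed

section \<open>Correctness of the output\<close>

lemma outputs_cube_representationI:
  fixes as bs :: "'v list" and s :: state
  defines "M \<equiv> \<lambda>i v. mem s (reg s 0 + i * (length as + length bs) + v)" and "N \<equiv> reg s 1"
  assumes graph: "bipartite_graph A B E" "edge_list_of as bs es A B E" and "N > 0"
    and edges: "\<And>i a b. (a, b) \<in> set es \<Longrightarrow> close N (M i a) (M i (length as + b))"
    and same: "\<And>u v. u \<noteq> v \<Longrightarrow> u < length as \<and> v < length as \<or>
        length as \<le> u \<and> u < length as + length bs \<and> length as \<le> v \<and> v < length as + length bs \<Longrightarrow>
      \<exists>i<k. \<not> close N (M i u) (M i v)"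
    and nonedges: "\<And>a b. a < length as \<Longrightarrow> b < length bs \<Longrightarrow> (a, b) \<notin> set es \<Longrightarrow>
      \<exists>i<k. \<not> close N (M i a) (M i (length as + b))"
  shows "outputs_cube_representation k (as @ bs) E s"
proof -
  let ?vs = "as @ bs" and ?n = "length as + length bs"
  have G: "distinct as" "set as = A" "distinct bs" "set bs = B" "A \<inter> B = {}"
    "set es \<subseteq> {..<length as} \<times> {..<length bs}" "E = (\<lambda>(i, j). {as ! i, bs ! j}) ` set es"
    using graph by (auto simp: bipartite_graph_def edge_list_of_def)
  have dist: "distinct ?vs" using G by simp
  \<comment> \<open>Output is indexed by position, a representation by vertex. The vertex list is
    distinct, so the position can be recovered.\<close>
  define f where "f v = output_cube k ?n s (the_inv_into {..<?n} ((!) ?vs) v)" for v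
  have inj: "inj_on ((!) ?vs) {..<?n}"
    using inj_on_nth[OF dist, of "{..<?n}"] by simp
  have f: "f (?vs ! j) = output_cube k ?n s j" if "j < ?n" for j
    using that by (simp only: f_def the_inv_into_f_f[OF inj] lessThan_iff)
  have meet: "f (?vs ! u) \<inter> f (?vs ! v) \<noteq> {} \<longleftrightarrow> (\<forall>i<k. close N (M i u) (M i v))"
    if "u < ?n" "v < ?n" for u v
    unfolding f[OF that(1)] f[OF that(2)] M_def N_def
    using output_cubes_intersect_iff[of s k ?n u v] \<open>N > 0\<close> by (simp add: N_def)
  have edge: "{as ! a, bs ! b} \<in> E \<longleftrightarrow> (a, b) \<in> set es" if "a < length as" "b < length bs" for a b
  proof
    assume "{as ! a, bs ! b} \<in> E"
    then obtain i j where ij: "(i, j) \<in> set es" "{as ! a, bs ! b} = {as ! i, bs ! j}"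
      using G(7) by auto
    then have "i < length as" "j < length bs" using G(6) by auto
    moreover from this have "as ! a \<noteq> bs ! j"
      using nth_mem[OF that(1)] nth_mem[of j bs] G(2,4,5) by fastforce
    ultimately have "as ! a = as ! i" "bs ! b = bs ! j"
      using ij(2) by (auto simp: doubleton_eq_iff)
    then have "a = i" "b = j"
      using that \<open>i < _\<close> \<open>j < _\<close> G(1,3) by (auto simp: nth_eq_iff_index_eq)
    then show "(a, b) \<in> set es" using ij(1) by simp
  qed (use G(7) in auto)
  have sides: "x \<in> A \<and> y \<in> B \<or> x \<in> B \<and> y \<in> A" if xy: "{x, y} \<in> E" for x y
  proof -
    obtain a b where "a \<in> A" "b \<in> B" "{x, y} = {a, b}"
      using xy graph(1) unfolding bipartite_graph_def by blast
    then show ?thesis by (auto simp: doubleton_eq_iff)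
  qed
  have bip: "x \<in> A \<Longrightarrow> y \<in> A \<Longrightarrow> {x, y} \<notin> E" "x \<in> B \<Longrightarrow> y \<in> B \<Longrightarrow> {x, y} \<notin> E" for x y
    using sides[of x y] G(5) by blast+
  \<comment> \<open>Ordering the positions leaves three cases, both in the first list, both in the
    second, or one in each; the reverse order follows by symmetry.\<close>
  have main: "{?vs ! u, ?vs ! v} \<in> E \<longleftrightarrow> f (?vs ! u) \<inter> f (?vs ! v) \<noteq> {}" if "u < v" "v < ?n" for u v
  proof -
    have lt: "u < ?n" using that by simp
    consider "v < length as" | "length as \<le> u" | "u < length as" "length as \<le> v"
      by linarith
    then show ?thesis
    proof cases
      case 1
      then have "?vs ! u \<in> A" "?vs ! v \<in> A" using that G(2) by (auto simp: nth_append)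
      then have "{?vs ! u, ?vs ! v} \<notin> E" by (rule bip)
      moreover have "\<exists>i<k. \<not> close N (M i u) (M i v)" using 1 that by (intro same) auto
      ultimately show ?thesis unfolding meet[OF lt that(2)] by blast
    next
      case 2
      then have "?vs ! u \<in> B" "?vs ! v \<in> B" using that G(4) by (auto simp: nth_append)
      then have "{?vs ! u, ?vs ! v} \<notin> E" by (rule bip)
      moreover have "\<exists>i<k. \<not> close N (M i u) (M i v)" using 2 that by (intro same) auto
      ultimately show ?thesis unfolding meet[OF lt that(2)] by blast
    next
      case 3
      define b where "b = v - length as"
      have v: "v = length as + b" "b < length bs" using 3 that(2) by (auto simp: b_def)
      have "{?vs ! u, ?vs ! v} \<in> E \<longleftrightarrow> (u, b) \<in> set es"
        using edge[OF 3(1) v(2)] 3(1) v(1) by (simp add: nth_append)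
      also have "\<dots> \<longleftrightarrow> (\<forall>i<k. close N (M i u) (M i v))"
        using edges[of u b] nonedges[OF 3(1) v(2)] unfolding v(1) by blast
      finally show ?thesis unfolding meet[OF lt that(2)] .
    qed
  qed
  have "cube_representation k (set ?vs) E f"
    unfolding cube_representation_def
  proof (intro conjI ballI impI)
    show "\<exists>a. f v = cube k a" if "v \<in> set ?vs" for v
      by (auto simp: f_def output_cube_def)
    fix x y assume "x \<in> set ?vs" "y \<in> set ?vs" "x \<noteq> y"
    then obtain u v where uv: "u < ?n" "v < ?n" "x = ?vs ! u" "y = ?vs ! v"
      by (metis in_set_conv_nth length_append)
    then have "u \<noteq> v" using \<open>x \<noteq> y\<close> by blast
    then consider "u < v" | "v < u" by linarith
    then show "{x, y} \<in> E \<longleftrightarrow> f x \<inter> f y \<noteq> {}"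
    proof cases
      case 1
      then show ?thesis using main[OF 1 uv(2)] uv(3,4) by simp
    next
      case 2
      then show ?thesis using main[OF 2 uv(1)] uv(3,4) by (simp add: insert_commute Int_commute)
    qed
  qed
  then show ?thesis unfolding outputs_cube_representation_def
    using f \<open>N > 0\<close> by (auto simp: N_def intro!: exI[of _ f])
qed

text \<open>Each edge is listed exactly once, so the parameters of the graph agree with what the
  machine counts on the list.\<close>

lemma edge_list_card:
  assumes graph: "bipartite_graph A B E" "edge_list_of as bs es A B E"
  shows "card E = length es"
    "max_degree E A = max_occurrences (\<lambda>j. fst (es ! j)) (length es)"
    "max_degree E B = max_occurrences (\<lambda>j. snd (es ! j)) (length es)"
proof -
  let ?h = "\<lambda>(i, j). {as ! i, bs ! j}"
  have G: "distinct as" "set as = A" "distinct bs" "set bs = B" "A \<inter> B = {}"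
    "set es \<subseteq> {..<length as} \<times> {..<length bs}" "E = ?h ` set es" "distinct es"
    using graph by (auto simp: bipartite_graph_def edge_list_of_def)
  have AB: "as ! i \<noteq> bs ! j" if "i < length as" "j < length bs" for i j
    using nth_mem[OF that(1)] nth_mem[OF that(2)] G(2,4,5) by fastforce
  have inj: "inj_on ?h (set es)"
  proof (rule inj_onI, clarify)
    fix i j i' j' assume ij: "(i, j) \<in> set es" "(i', j') \<in> set es" "{as ! i, bs ! j} = {as ! i', bs ! j'}"
    then have lt: "i < length as" "j < length bs" "i' < length as" "j' < length bs" using G(6) by auto
    then have "as ! i = as ! i'" "bs ! j = bs ! j'"
      using ij(3) AB by (auto simp: doubleton_eq_iff)
    then show "i = i' \<and> j = j'" using lt G(1,3) by (auto simp: nth_eq_iff_index_eq)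
  qed
  show "card E = length es"
    unfolding G(7) using card_image[OF inj] distinct_card[OF G(8)] by simp
  have count: "card {p \<in> set es. g p = v} = occurrences (\<lambda>j. g (es ! j)) (length es) v"
    for g :: "nat \<times> nat \<Rightarrow> nat" and v
  proof -
    have "{p \<in> set es. g p = v} = (!) es ` {j. j < length es \<and> g (es ! j) = v}"
      by (auto simp: in_set_conv_nth image_iff) (metis)
    moreover have "inj_on ((!) es) {j. j < length es \<and> g (es ! j) = v}"
      using G(8) by (intro inj_on_nth) auto
    ultimately show ?thesis by (simp add: card_image occurrences_eq_card)
  qed
  have deg: "card {e \<in> E. w \<in> e} = card {p \<in> set es. g p = v}"
    if "\<And>p. p \<in> set es \<Longrightarrow> w \<in> ?h p \<longleftrightarrow> g p = v" for w g and v :: nat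
  proof -
    have "{e \<in> E. w \<in> e} = ?h ` {p \<in> set es. g p = v}" unfolding G(7) using that by blast
    moreover have "inj_on ?h {p \<in> set es. g p = v}" using inj by (rule inj_on_subset) auto
    ultimately show ?thesis by (simp add: card_image)
  qed
  have "as ! v \<in> ?h p \<longleftrightarrow> fst p = v" if "v < length as" "p \<in> set es" for v p
    using that G(6) AB[of v "snd p"] nth_eq_iff_index_eq[OF G(1) that(1), of "fst p"]
    by (cases p) auto
  then have degA: "degree E (as ! v) = occurrences (\<lambda>j. fst (es ! j)) (length es) v"
    if "v < length as" for v
    unfolding degree_def count[symmetric] using that by (intro deg) blast
  have "bs ! v \<in> ?h p \<longleftrightarrow> snd p = v" if "v < length bs" "p \<in> set es" for v p
    using that G(6) AB[of "fst p" v] nth_eq_iff_index_eq[OF G(3) that(1), of "snd p"]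
    by (cases p) auto
  then have degB: "degree E (bs ! v) = occurrences (\<lambda>j. snd (es ! j)) (length es) v"
    if "v < length bs" for v
    unfolding degree_def count[symmetric] using that by (intro deg) blast
  have max: "max_degree E (set xs) = max_occurrences g (length es)"
    if "\<And>v. v < length xs \<Longrightarrow> degree E (xs ! v) = occurrences g (length es) v"
      "\<And>j. j < length es \<Longrightarrow> g j < length xs" for xs g
  proof -
    \<comment> \<open>Numbers that are not vertices contribute only zeros, so the maximum over all
      numbers is the maximum over the side. The inserted 0 covers an empty side.\<close>
    have zero: "occurrences g (length es) v = 0" if "\<not> v < length xs" for v
      using that \<open>\<And>j. j < length es \<Longrightarrow> g j < length xs\<close>
      by (auto simp: occurrences_eq_card)
    have "degree E ` set xs = occurrences g (length es) ` {..<length xs}"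
      using that(1) by (force simp: set_conv_nth image_iff)
    moreover have "insert 0 (occurrences g (length es) ` {..<length xs})
        = insert 0 (range (occurrences g (length es)))"
      using zero by (auto simp: image_iff)
    ultimately show ?thesis by (simp add: max_degree_def max_occurrences_eq)
  qed
  have "fst (es ! j) < length as" "snd (es ! j) < length bs" if "j < length es" for j
    using G(6) nth_mem[OF that] by auto
  then show "max_degree E A = max_occurrences (\<lambda>j. fst (es ! j)) (length es)"
    "max_degree E B = max_occurrences (\<lambda>j. snd (es ! j)) (length es)"
    using max[of as] max[of bs] degA degB G(2,4) by auto
qed

section \<open>Dimension, failure probability and running time\<close>

lemma ceil_div_bounds:
  assumes "b > 0"
  shows "real a / real b \<le> real (ceil_div a b)" "real (ceil_div a b) < real a / real b + 1"
proof -
  have "real a \<le> real (ceil_div a b) * real b"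
    using le_ceil_div_mult[OF assms, of a] by (metis of_nat_le_iff of_nat_mult)
  then show "real a / real b \<le> real (ceil_div a b)" using assms by (simp add: divide_le_eq)
  have "ceil_div a b * b \<le> a + b - 1" by (simp add: ceil_div_def)
  then have "ceil_div a b * b < a + b" using assms by linarith
  then have "real (ceil_div a b) * real b < real a + real b"
    by (metis of_nat_add of_nat_less_iff of_nat_mult)
  then show "real (ceil_div a b) < real a / real b + 1" using assms by (simp add: field_simps)
qed

text \<open>The difference of harmonic number and logarithm decreases from its first value,
  1.\<close>

lemma harm_le_ln_add_1:
  assumes "n > 0"
  shows "harm n \<le> ln (real n) + 1"
  using decseqD[OF decseq_harm_diff_ln, of 0 "n - 1"] assms by (simp add: harm_def)

lemma ln_le_harm_self:
  assumes "n > 0"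
  shows "ln (real n) \<le> harm n"
proof -
  have "ln (real n) \<le> ln (real n + 1)" using assms by simp
  then show ?thesis using ln_le_harm[of n] by linarith
qed

text \<open>Rounding up adds at most 1 to each of the \<open>n\<close> summands of n times the
  harmonic number, and the harmonic number exceeds the logarithm by at most 1; together this gives
  the 2.\<close>

lemma ceil_div_sum_bounds:
  assumes "n > 0"
  defines "S \<equiv> \<Sum>i=1..n. ceil_div n i"
  shows "real n * ln (real n) \<le> real S" "real S \<le> real n * (ln (real n) + 2)"
proof -
  have harm: "(\<Sum>i=1..n. real n / real i) = real n * harm n"
    unfolding harm_def divide_inverse by (rule sum_distrib_left[symmetric])
  have "real n * ln (real n) \<le> real n * harm n"
    using ln_le_harm_self[OF assms(1)] by (intro mult_left_mono) auto
  also have "\<dots> \<le> real S"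
    unfolding harm[symmetric] S_def of_nat_sum using ceil_div_bounds(1) by (intro sum_mono) auto
  finally show "real n * ln (real n) \<le> real S" .
  have "real S \<le> (\<Sum>i=1..n. real n / real i + 1)"
    unfolding S_def of_nat_sum using ceil_div_bounds(2) by (intro sum_mono less_imp_le) auto
  also have "\<dots> = real n * (harm n + 1)" unfolding sum.distrib harm by (simp add: algebra_simps)
  also have "\<dots> \<le> real n * (ln (real n) + 2)"
    using harm_le_ln_add_1[OF assms(1)] by (intro mult_left_mono) auto
  finally show "real S \<le> real n * (ln (real n) + 2)" .
qed

text \<open>The final division, again rounded up, contributes one more unit to the error.\<close>

lemma rounds_bounds:
  assumes "n > 0"
  shows "ln (real n) \<le> real (rounds n)" "real (rounds n) < ln (real n) + 3"
proof -
  let ?S = "\<Sum>i=1..n. ceil_div n i"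
  have "ln (real n) \<le> real ?S / real n" "real ?S / real n \<le> ln (real n) + 2"
    using ceil_div_sum_bounds[OF assms] assms by (simp_all add: field_simps)
  then show "ln (real n) \<le> real (rounds n)" "real (rounds n) < ln (real n) + 3"
    unfolding rounds_def using ceil_div_bounds[OF assms, of ?S] by linarith+
qed

lemma ln_ge_two_thirds:
  assumes "2 \<le> n"
  shows "2 / 3 \<le> ln (real n)"
proof -
  have "ln 2 \<le> ln (real n)" using assms by simp
  then show ?thesis using ln2_ge_two_thirds by linarith
qed

text \<open>Here 2 ^ K < 4 N, and 1 / ln 2 \<le> 3 / 2. The slope 3 / 2 is what makes two rows per
  digit fit, up to four rows, into 3 \<lceil>ln N\<rceil> dimensions.\<close>

lemma bit_length_le:
  assumes n: "n \<le> 2 * N" "0 < N" and K: "\<And>j. j < K \<Longrightarrow> 2 ^ j < n"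
  shows "real K \<le> 3 / 2 * ln (real N) + 2"
proof (cases "K = 0")
  case True
  then show ?thesis using assms by simp
next
  case False
  then have "2 ^ (K - 1) < n" using K[of "K - 1"] by simp
  then have "2 * 2 ^ (K - 1) < 4 * N" using n(1) by linarith
  then have "(2::nat) ^ K < 4 * N" using False by (simp add: power_eq_if)
  then have "(2::real) ^ K \<le> 4 * real N"
    by (metis less_imp_le of_nat_le_iff of_nat_mult of_nat_numeral of_nat_power)
  then have "ln ((2::real) ^ K) \<le> ln (2 * 2 * real N)" using n(2) by (subst ln_le_cancel_iff) auto
  moreover have "ln (4::real) = 2 * ln 2" using ln_realpow[of 2 2] by simp
  ultimately have *: "real K * ln 2 \<le> 2 * ln 2 + ln (real N)"
    using n(2) by (simp add: ln_realpow ln_mult)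
  show ?thesis
  proof (rule ccontr)
    assume "\<not> ?thesis"
    then have "3 / 2 * ln (real N) < real K - 2" by simp
    then have "3 / 2 * ln (real N) * ln 2 < (real K - 2) * ln 2" by (intro mult_strict_right_mono) auto
    also have "\<dots> \<le> ln (real N)" using * by (simp add: algebra_simps)
    finally have "3 / 2 * ln (real N) * ln 2 < ln (real N)" .
    moreover have "ln (real N) * (2 / 3) \<le> ln (real N) * ln 2"
      using ln2_ge_two_thirds n(2) by (intro mult_left_mono) auto
    ultimately show False by simp
  qed
qed

text \<open>Replacing d + 1 by d + 2 leaves 3 c dimensions for the digits, while these may take 3 c
  + 4 rows. The overrun is paid by omitted groups of random rows, or, if there are no random rows,
  by the dimensions reserved for them.\<close>

lemma dimension_le:
  assumes N: "2 \<le> N" and K: "real K \<le> 3 / 2 * ln (real N) + 2"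
  shows "2 * K + 3 * Suc d * (rounds N - 5) \<le> 3 * (d + 2) * nat \<lceil>ln (real N)\<rceil>"
proof -
  define c where "c = nat \<lceil>ln (real N)\<rceil>"
  have "0 < ln (real N)" using N by simp
  then have c: "ln (real N) \<le> real c" "c \<ge> 1" unfolding c_def by linarith+
  have K': "real K \<le> 3 / 2 * real c + 2" using K c(1) by linarith
  show ?thesis
  proof (cases "rounds N \<le> 5")
    case True
    have "2 * K \<le> 3 * 2 * c"
    proof (cases "c = 1")
      case True
      \<comment> \<open>For c = 1 the real bound 7 / 2 is too weak by itself; integrality gives K
        \<le> 3 and thus six rows.\<close>
      then have "real K < real 4" using K' by simp
      then have "K < 4" by (simp only: of_nat_less_iff)
      then show ?thesis using True by simp
    next
      case False
      then have "2 \<le> real c" using c(2) by linarith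
      then have "real (2 * K) \<le> real (3 * 2 * c)" using K' by simp
      then show ?thesis by linarith
    qed
    also have "\<dots> \<le> 3 * (d + 2) * c" by (intro mult_right_mono) auto
    finally show ?thesis using True by (simp add: c_def)
  next
    case False
    define l where "l = rounds N - 5"
    have "real (rounds N) < real c + 3" using rounds_bounds(2)[of N] N c(1) by linarith
    \<comment> \<open>Two omitted groups free at least six rows, enough for the overrun of
      four.\<close>
    then have l: "l + 2 \<le> c" using False by (simp add: l_def)
    then have "3 * Suc d * l + 6 * Suc d \<le> 3 * Suc d * c"
      using mult_left_mono[OF l, of "3 * Suc d"] by (simp add: algebra_simps)
    moreover have "2 * K \<le> 3 * c + 4" using K' by linarith
    ultimately have "2 * K + 3 * Suc d * l \<le> 3 * (d + 2) * c" by (simp add: algebra_simps)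
    then show ?thesis by (simp add: c_def l_def)
  qed
qed

text \<open>By 1 - x \<le> exp (-x), a group of 3 (d + 1) rows contributes a factor of at most exp
  (-3). At most n2 ^ 2 pairs against n2 ^ (-3) leave 1 / n2, which is at most 2 / (n1 + n2).\<close>

lemma failure_le:
  assumes "2 \<le> n2" "n1 \<le> n2"
  shows "real (n1 * n2) * (real d / (real d + 1)) ^ (3 * Suc d * (rounds n2 - 5))
    \<le> 2 * exp 15 / real (n1 + n2)"
proof -
  let ?l = "rounds n2 - 5"
  have "real d / (real d + 1) = 1 + - (1 / (real d + 1))" by (simp add: field_simps)
  also have "\<dots> \<le> exp (- (1 / (real d + 1)))" by (rule exp_ge_add_one_self)
  finally have "(real d / (real d + 1)) ^ (3 * Suc d * ?l) \<le> exp (- (1 / (real d + 1))) ^ (3 * Suc d * ?l)"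
    by (intro power_mono) auto
  also have "\<dots> = exp (real (3 * Suc d * ?l) * - (1 / (real d + 1)))"
    by (rule exp_of_nat_mult[symmetric])
  also have "real (3 * Suc d * ?l) * - (1 / (real d + 1)) = - 3 * real ?l"
    by (simp add: divide_simps)
  \<comment> \<open>The 15 is three times the five omitted groups. Truncation in
    \<open>rounds n2 - 5\<close> can only increase the exponent in our favour.\<close>
  also have "exp (- 3 * real ?l) \<le> exp (15 - 3 * ln (real n2))"
    using rounds_bounds(1)[of n2] assms by simp
  also have "\<dots> = exp 15 / real n2 ^ 3"
    using assms by (simp add: exp_diff exp_of_nat_mult[of 3 "ln (real n2)", simplified])
  finally have p: "(real d / (real d + 1)) ^ (3 * Suc d * ?l) \<le> exp 15 / real n2 ^ 3" .
  have "real (n1 * n2) * (real d / (real d + 1)) ^ (3 * Suc d * ?l)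
      \<le> real (n2 * n2) * (exp 15 / real n2 ^ 3)"
    using assms p by (intro mult_mono) auto
  also have "\<dots> = exp 15 / real n2" using assms by (simp add: power3_eq_cube)
  also have "\<dots> \<le> 2 * exp 15 / real (n1 + n2)" using assms by (simp add: field_simps)
  finally show ?thesis .
qed

text \<open>Since ln n2 \<ge> 2 / 3, additive constants and linear terms are absorbed into the
  product with the logarithm; \<open>max 1 d\<close> covers graphs without edges, which still take
  time.\<close>

lemma time_le:
  assumes n2: "2 \<le> n2" and n: "n = n1 + n2" and K: "real K \<le> 3 / 2 * ln (real n2) + 2"
  shows "real (42 + 18 * m + 4 * n2 + 3 * (\<Sum>i=1..n2. ceil_div n2 i) + 3 * rounds n2 +
        K * (24 * n + 21) + 3 * Suc d * (rounds n2 - 5) * (5 * n + 16 * m + 13))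
    \<le> 400 * (real (max 1 d) * real (m + n) * ln (real n2))"
proof -
  define L where "L = ln (real n2)"
  define N where "N = real (m + n)"
  define D where "D = real (max 1 d)"
  let ?S = "\<Sum>i=1..n2. ceil_div n2 i"
  have L: "2 / 3 \<le> L" using ln_ge_two_thirds[OF n2] by (simp add: L_def)
  have N: "2 \<le> N" "real n2 \<le> N" "real m \<le> N" "real n \<le> N" "real m + real n = N"
    using n2 n by (auto simp: N_def)
  have D: "1 \<le> D" "real d \<le> D" by (simp_all add: D_def)
  have NL: "2 / 3 * N \<le> N * L" using mult_left_mono[OF L, of N] N by (simp add: mult.commute)
  have "real ?S \<le> real n2 * (L + 2)" using ceil_div_sum_bounds(2)[of n2] n2 by (simp add: L_def)
  also have "\<dots> \<le> N * (4 * L)" using L N by (intro mult_mono) auto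
  finally have S: "real ?S \<le> 4 * (N * L)" by simp
  have "real (rounds n2) \<le> 11 / 2 * L" using rounds_bounds(2)[of n2] n2 L by (simp add: L_def)
  moreover have "2 * L \<le> N * L" using N L by (intro mult_right_mono) auto
  ultimately have R: "real (rounds n2) \<le> 11 / 4 * (N * L)" by linarith
  have "real K * real (24 * n + 21) \<le> 9 / 2 * L * (35 * N)"
    using K L N by (intro mult_mono) (auto simp: L_def)
  then have K': "real (K * (24 * n + 21)) \<le> 315 / 2 * (N * L)" by (simp add: algebra_simps)
  have "real (rounds n2 - 5) \<le> L" using rounds_bounds(2)[of n2] n2 L by (simp add: L_def)
  then have "real (3 * Suc d) * real (rounds n2 - 5) * real (5 * n + 16 * m + 13)
      \<le> (6 * D) * L * (23 * N)"
    using D L N by (intro mult_mono) auto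
  then have T: "real (3 * Suc d * (rounds n2 - 5) * (5 * n + 16 * m + 13)) \<le> 138 * (D * N * L)"
    by (simp only: of_nat_mult) (simp add: algebra_simps)
  have "1 * (N * L) \<le> D * (N * L)" using D N L by (intro mult_right_mono) auto
  then have DN: "N * L \<le> D * N * L" by simp
  have "real (42 + 18 * m + 4 * n2 + 3 * ?S + 3 * rounds n2 + K * (24 * n + 21) +
      3 * Suc d * (rounds n2 - 5) * (5 * n + 16 * m + 13))
    = 42 + 18 * real m + 4 * real n2 + 3 * real ?S + 3 * real (rounds n2) + real (K * (24 * n + 21))
      + real (3 * Suc d * (rounds n2 - 5) * (5 * n + 16 * m + 13))"
    by (simp only: of_nat_add of_nat_mult of_nat_numeral)
  \<comment> \<open>The main contributions are 138 from the random rows and 315 / 2 from the digit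
    rows; the remaining terms fit into what is left of 400.\<close>
  also have "\<dots> \<le> 400 * (D * N * L)"
    using NL S R K' T DN N by linarith
  finally show ?thesis by (simp only: D_def N_def L_def)
qed

text \<open>One program and one pair of constants serve all graphs. High probability means failure
  at most C / n, and the time bound holds for every outcome. Since \<open>None\<close> is excluded
  for the fuel \<open>f\<close>, the distribution is the final one.\<close>

theorem theorem3p2:
  "\<exists>(P :: prog) (c :: real) (C :: real).
     \<forall>(A :: nat set) (B :: nat set) (E :: nat set set) as bs es n1 n2 n m \<Delta>.
       bipartite_graph A B E \<and> edge_list_of as bs es A B E \<and>
       n1 = card A \<and> n2 = card B \<and> n1 \<le> n2 \<and> 2 \<le> n2 \<and>
       n = n1 + n2 \<and> m = card E \<and>
       \<Delta> = min (max_degree E A) (max_degree E B) \<longrightarrow>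
       (\<exists>f. let D = exec f P (initial_state (graph_input as bs es));
                k = 3 * (\<Delta> + 2) * nat \<lceil>ln (real n2)\<rceil>
            in (\<forall>res\<in>set_pmf D. \<exists>s. res = Some s \<and>
                  real (elapsed s) \<le> c * (real (max 1 \<Delta>) * real (m + n) * ln (real n2))) \<and>
               measure_pmf.prob D {Some s | s. outputs_cube_representation k (as @ bs) E s}
                 \<ge> 1 - C / real n)"
proof (rule exI[of _ main_prog], rule exI[of _ 400], rule exI[of _ "2 * exp 15"], intro allI impI)
  fix A B :: "nat set" and E :: "nat set set" and as bs es n1 n2 n m \<Delta>
  assume asm: "bipartite_graph A B E \<and> edge_list_of as bs es A B E \<and>
       n1 = card A \<and> n2 = card B \<and> n1 \<le> n2 \<and> 2 \<le> n2 \<and>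
       n = n1 + n2 \<and> m = card E \<and> \<Delta> = min (max_degree E A) (max_degree E B)"
  then have graph: "bipartite_graph A B E" "edge_list_of as bs es A B E"
    and es: "set es \<subseteq> {..<length as} \<times> {..<length bs}"
    and len: "length as = n1" "length bs = n2"
    and n: "n1 \<le> n2" "2 \<le> n2" "n = n1 + n2"
    by (auto simp: edge_list_of_def distinct_card)
  have m: "length es = m" and \<Delta>: "min (max_occurrences (\<lambda>j. fst (es ! j)) m)
      (max_occurrences (\<lambda>j. snd (es ! j)) m) = \<Delta>"
    using asm edge_list_card[OF graph] by auto
  define K where "K = (LEAST K. n \<le> 2 ^ K)"
  \<comment> \<open>The least exponent is the number of digit rounds the program performs; n itself
    witnesses existence.\<close>
  have K1: "n \<le> 2 ^ K" unfolding K_def by (rule LeastI[of _ n]) simp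
  have K2: "2 ^ j < n" if "j < K" for j
    using not_less_Least[OF that[unfolded K_def]] by simp
  have K: "real K \<le> 3 / 2 * ln (real n2) + 2" using n K2 by (intro bit_length_le[of n]) auto
  define T where "T = 3 + 2 * m + n1 + n2"
  define t where "t = 3 * Suc \<Delta> * (rounds n2 - 5)"
  define k where "k = 3 * (\<Delta> + 2) * nat \<lceil>ln (real n2)\<rceil>"
  define J where "J = {(a, b). a < n1 \<and> b < n2 \<and> (a, b) \<notin> set es}"
  define S where "S p = {s :: state. \<forall>i<2 * K + t. close n (mem s (T + i * n + fst p))
          (mem s (T + i * n + (n1 + snd p)))}" for p
  from yields_main_prog[OF es, unfolded len m \<Delta> n(3)[symmetric], OF _ K1 K2]
  obtain D where "yields main_prog (initial_state (graph_input as bs es)) D" and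
    D: "\<And>s. s \<in> set_pmf D \<Longrightarrow> reg s 0 = T \<and> reg s 1 = n \<and>
      (\<forall>i. \<forall>(a, b)\<in>set es.
        close n (mem s (T + i * n + a)) (mem s (T + i * n + (n1 + b)))) \<and>
      (\<forall>u v. u \<noteq> v \<longrightarrow> u < n1 \<and> v < n1 \<or> n1 \<le> u \<and> u < n \<and> n1 \<le> v \<and> v < n \<longrightarrow>
        (\<exists>i<2 * K. \<not> close n (mem s (T + i * n + u)) (mem s (T + i * n + v)))) \<and>
      elapsed s \<le> 42 + 18 * m + 4 * n2 +
        3 * (\<Sum>i=1..n2. ceil_div n2 i) + 3 * rounds n2 +
        K * (24 * n + 21) + t * (5 * n + 16 * m + 13)" and
    P: "\<And>p. p \<in> J \<Longrightarrow> measure_pmf.prob D (S p) \<le> (real \<Delta> / (real \<Delta> + 1)) ^ t"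
    using n(2) unfolding T_def[symmetric] t_def[symmetric] J_def[symmetric] S_def[symmetric] by auto
  then have "\<forall>\<^sub>F f in sequentially. exec f main_prog (initial_state (graph_input as bs es)) = map_pmf Some D"
    by (simp add: yields_def)
  then obtain f where f: "exec f main_prog (initial_state (graph_input as bs es)) = map_pmf Some D"
    using eventually_happens'[OF sequentially_bot] by blast
  have time: "real (elapsed s) \<le> 400 * (real (max 1 \<Delta>) * real (m + n) * ln (real n2))"
    if "s \<in> set_pmf D" for s
  proof -
    have "elapsed s \<le> 42 + 18 * m + 4 * n2 + 3 * (\<Sum>i=1..n2. ceil_div n2 i) + 3 * rounds n2 +
        K * (24 * n + 21) + t * (5 * n + 16 * m + 13)" using D[OF that] by blast
    then show ?thesis
      using time_le[OF n(2,3) K, of m \<Delta>] unfolding t_def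
      by (meson of_nat_le_iff order_trans)
  qed
  \<comment> \<open>Separation found among the written rows thus lies within the \<open>k\<close>
    dimensions; the other dimensions are zero rows.\<close>
  have dim: "2 * K + t \<le> k" using dimension_le[OF n(2) K] by (simp add: k_def t_def)
  let ?O = "{s. outputs_cube_representation k (as @ bs) E s}"
  have out: "s \<in> ?O" if s: "s \<in> set_pmf D" and sep: "\<And>p. p \<in> J \<Longrightarrow> s \<notin> S p" for s
  proof -
    have r: "reg s 0 = T" "reg s 1 = n" using D[OF s] by blast+
    have "outputs_cube_representation k (as @ bs) E s"
    proof (rule outputs_cube_representationI[OF graph], unfold len n(3)[symmetric])
      show "0 < reg s 1" using D[OF s] n by simp
      show "close (reg s 1) (mem s (reg s 0 + i * n + a)) (mem s (reg s 0 + i * n + (n1 + b)))"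
        if "(a, b) \<in> set es" for i a b
        using D[OF s] that by auto
      show "\<exists>i<k. \<not> close (reg s 1) (mem s (reg s 0 + i * n + u)) (mem s (reg s 0 + i * n + v))"
        if uv: "u \<noteq> v" "u < n1 \<and> v < n1 \<or> n1 \<le> u \<and> u < n \<and> n1 \<le> v \<and> v < n" for u v
      proof -
        obtain i where "i < 2 * K" "\<not> close n (mem s (T + i * n + u)) (mem s (T + i * n + v))"
          using D[OF s] uv by blast
        then show ?thesis using dim unfolding r by (intro exI[of _ i]) auto
      qed
      show "\<exists>i<k. \<not> close (reg s 1) (mem s (reg s 0 + i * n + a)) (mem s (reg s 0 + i * n + (n1 + b)))"
        if "a < n1" "b < n2" "(a, b) \<notin> set es" for a b
      proof -
        have "s \<notin> S (a, b)" using that by (intro sep) (simp add: J_def)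
        then obtain i where "i < 2 * K + t"
          "\<not> close n (mem s (T + i * n + a)) (mem s (T + i * n + (n1 + b)))"
          by (auto simp: S_def)
        then show ?thesis using dim unfolding r by (intro exI[of _ i]) auto
      qed
    qed
    then show ?thesis by simp
  qed
  have J: "J \<subseteq> {..<n1} \<times> {..<n2}" by (auto simp: J_def)
  then have finJ: "finite J" using finite_subset by blast
  \<comment> \<open>Only nonadjacent pairs of opposite sides can spoil the output, so the union
    bound runs over at most n1 * n2 events.\<close>
  have "measure_pmf.prob D (UNIV - ?O) \<le> measure_pmf.prob D (\<Union>p\<in>J. S p)"
    using out by (intro measure_pmf.finite_measure_mono_AE) (auto simp: AE_measure_pmf_iff)
  also have "\<dots> \<le> (\<Sum>p\<in>J. measure_pmf.prob D (S p))"
    using finJ by (intro measure_pmf.finite_measure_subadditive_finite) auto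
  also have "\<dots> \<le> (\<Sum>p\<in>J. (real \<Delta> / (real \<Delta> + 1)) ^ t)" by (intro sum_mono P)
  also have "\<dots> = real (card J) * (real \<Delta> / (real \<Delta> + 1)) ^ t" by simp
  also have "\<dots> \<le> real (n1 * n2) * (real \<Delta> / (real \<Delta> + 1)) ^ t"
    using card_mono[OF _ J] by (intro mult_right_mono of_nat_mono) auto
  also have "\<dots> \<le> 2 * exp 15 / real n"
    using failure_le[OF n(2,1), of \<Delta>] n(3) by (simp only: t_def)
  finally have "1 - measure_pmf.prob D ?O \<le> 2 * exp 15 / real n"
    using measure_pmf.prob_compl[of ?O D] by simp
  moreover have "Some -` {Some s | s. outputs_cube_representation k (as @ bs) E s} = ?O" by auto
  ultimately have prob: "1 - 2 * exp 15 / real n \<le> measure_pmf.prob (map_pmf Some D)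
      {Some s | s. outputs_cube_representation k (as @ bs) E s}"
    by simp
  show "\<exists>f. let D = exec f main_prog (initial_state (graph_input as bs es));
                k = 3 * (\<Delta> + 2) * nat \<lceil>ln (real n2)\<rceil>
            in (\<forall>res\<in>set_pmf D. \<exists>s. res = Some s \<and>
                  real (elapsed s) \<le> 400 * (real (max 1 \<Delta>) * real (m + n) * ln (real n2))) \<and>
               measure_pmf.prob D {Some s | s. outputs_cube_representation k (as @ bs) E s}
                 \<ge> 1 - 2 * exp 15 / real n"
    unfolding Let_def k_def[symmetric]
    using time prob by (intro exI[of _ f]) (auto simp: f)
qed

end
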